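(* Let $\mathbf{X}\in\mathbb{H}^{m\times n}$ be a quaternion matrix of rank $k$, with truncated quaternion singular value decomposition $\mathbf{X}=\mathbf{W}_k\mathbf{\Sigma}_k\mathbf{V}_k^H$. Let $I\subseteq[m]$ and $J\subseteq[n]$ with $|I|,|J|\ge k$, and put $\mathbf{C}=\mathbf{X}(:,J)$ and $\mathbf{R}=\mathbf{X}(I,:)$. Assume that the columns of $\mathbf{C}$ span the column space of $\mathbf{X}$ and the rows of $\mathbf{R}$ span the row space of $\mathbf{X}$. Let $\mathbf{E}\in\mathbb{H}^{m\times n}$ be arbitrary, and put $\tilde{\mathbf{X}}=\mathbf{X}+\mathbf{E}$, $\tilde{\mathbf{C}}=\tilde{\mathbf{X}}(:,J)$, $\tilde{\mathbf{R}}=\tilde{\mathbf{X}}(I,:)$, $\mathbf{E}_J=\mathbf{E}(:,J)$, $\mathbf{E}_I=\mathbf{E}(I,:)$. Then, with $\|\cdot\|$ denoting the spectral norm, $$\|\mathbf{X}-\tilde{\mathbf{C}}\tilde{\mathbf{C}}^{\dagger}\tilde{\mathbf{X}}\tilde{\mathbf{R}}^{\dagger}\tilde{\mathbf{R}}\|\leq \|\mathbf{E}_I\|\,\|\mathbf{X}\mathbf{R}^{\dagger}\| + \|\mathbf{E}_J\|\,\|\mathbf{C}^{\dagger}\mathbf{X}\| + 3\|\mathbf{E}\|.$$ Furthermore, $$\|\mathbf{X}-\tilde{\mathbf{C}}\tilde{\mathbf{C}}^{\dagger}\tilde{\mathbf{X}}\tilde{\mathbf{R}}^{\dagger}\tilde{\mathbf{R}}\|\leq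 \|\mathbf{E}\|\left(\|\mathbf{W}_{k,I}^{\dagger}\| + \|\mathbf{V}_{k,J}^{\dagger}\| +3\right),$$ where $\mathbf{W}_{k,I}=\mathbf{W}_k(I,:)\in\mathbb{H}^{|I|\times k}$ and $\mathbf{V}_{k,J}=\mathbf{V}_k(J,:)\in\mathbb{H}^{|J|\times k}$.
   Context: $\mathbb{H}$ denotes the real quaternions (basis $1,\mathbf{i},\mathbf{j},\mathbf{k}$ over $\mathbb{R}$, $\mathbf{i}^2=\mathbf{j}^2=\mathbf{k}^2=\mathbf{i}\mathbf{j}\mathbf{k}=-1$), and $[n]=\{1,\dots,n\}$. For a quaternion matrix $\mathbf{A}$, $\mathbf{A}^H$ is the conjugate transpose, $\mathbf{A}(I,:)$ and $\mathbf{A}(:,J)$ are the submatrices formed by the rows indexed by $I$ and the columns indexed by $J$, and $\mathbf{A}^\dagger$ is the Moore-Penrose inverse, i.e. the unique matrix with $\mathbf{A}\mathbf{A}^\dagger\mathbf{A}=\mathbf{A}$, $\mathbf{A}^\dagger\mathbf{A}\mathbf{A}^\dagger=\mathbf{A}^\dagger$, $(\mathbf{A}\mathbf{A}^\dagger)^H=\mathbf{A}\mathbf{A}^\dagger$, $(\mathbf{A}^\dagger\mathbf{A})^H=\mathbf{A}^\dagger\mathbf{A}$. The column space is the right $\mathbb{H}$-linear span of the columns, the row space is the left $\mathbb{H}$-linear span of the rows, and the rank is their common dimension. The spectral norm is $\|\mathbf{A}\|=\max_{\|\mathbf{x}\|_2=1}\|\mathbf{A}\mathbf{x}\|_2$ over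 quaternion vectors $\mathbf{x}$. The truncated quaternion singular value decomposition of a rank-$k$ matrix $\mathbf{X}\in\mathbb{H}^{m\times n}$ is $\mathbf{X}=\mathbf{W}_k\mathbf{\Sigma}_k\mathbf{V}_k^H$ with $\mathbf{W}_k\in\mathbb{H}^{m\times k}$, $\mathbf{V}_k\in\mathbb{H}^{n\times k}$ satisfying $\mathbf{W}_k^H\mathbf{W}_k=\mathbf{V}_k^H\mathbf{V}_k=\mathbf{I}_k$, and $\mathbf{\Sigma}_k$ the real $k\times k$ diagonal matrix of the $k$ positive singular values of $\mathbf{X}$. *)

theory Defs
  imports Complex_Main "Jordan_Normal_Form.Matrix" "Jordan_Normal_Form.DL_Submatrix"
begin

section \<open>Quaternions\<close>

text \<open>\<open>Quat a b c d\<close> stands for \<open>a + b i + c j + d k\<close>.\<close>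

datatype quaternion = Quat (qre: real) (qim1: real) (qim2: real) (qim3: real)

lemma quaternion_eq_iff:
  "x = y \<longleftrightarrow> qre x = qre y \<and> qim1 x = qim1 y \<and> qim2 x = qim2 y \<and> qim3 x = qim3 y"
  by (cases x; cases y) simp

instantiation quaternion :: ring_1
begin

definition "0 = Quat 0 0 0 0"
definition "1 = Quat 1 0 0 0"
definition "x + y = Quat (qre x + qre y) (qim1 x + qim1 y) (qim2 x + qim2 y) (qim3 x + qim3 y)"
definition "x - y = Quat (qre x - qre y) (qim1 x - qim1 y) (qim2 x - qim2 y) (qim3 x - qim3 y)"
definition "- x = Quat (- qre x) (- qim1 x) (- qim2 x) (- qim3 x)"
definition "x * y = Quat
  (qre x * qre y - qim1 x * qim1 y - qim2 x * qim2 y - qim3 x * qim3 y)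
  (qre x * qim1 y + qim1 x * qre y + qim2 x * qim3 y - qim3 x * qim2 y)
  (qre x * qim2 y - qim1 x * qim3 y + qim2 x * qre y + qim3 x * qim1 y)
  (qre x * qim3 y + qim1 x * qim2 y - qim2 x * qim1 y + qim3 x * qre y)"

lemmas quaternion_ring_defs = zero_quaternion_def one_quaternion_def plus_quaternion_def
  minus_quaternion_def uminus_quaternion_def times_quaternion_def

instance
  by standard (auto simp: quaternion_ring_defs quaternion_eq_iff algebra_simps)

end

instantiation quaternion :: real_algebra_1
begin

definition "scaleR r x = Quat (r * qre x) (r * qim1 x) (r * qim2 x) (r * qim3 x)"

instance
  by standard (auto simp: scaleR_quaternion_def quaternion_ring_defs quaternion_eq_iff algebra_simps)

end

definition qcnj :: "quaternion \<Rightarrow> quaternion" where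
  "qcnj x = Quat (qre x) (- qim1 x) (- qim2 x) (- qim3 x)"

lemma quaternion_units:
  defines "i \<equiv> Quat 0 1 0 0" and "j \<equiv> Quat 0 0 1 0" and "k \<equiv> Quat 0 0 0 1"
  shows "i * i = -1" "j * j = -1" "k * k = -1" "i * j * k = -1"
    and "Quat a b c d = a *\<^sub>R 1 + b *\<^sub>R i + c *\<^sub>R j + d *\<^sub>R k"
  by (auto simp: i_def j_def k_def scaleR_quaternion_def quaternion_ring_defs)

instantiation quaternion :: real_normed_div_algebra
begin

definition "norm x = sqrt ((qre x)\<^sup>2 + (qim1 x)\<^sup>2 + (qim2 x)\<^sup>2 + (qim3 x)\<^sup>2)"
definition sgn_quaternion_def: "sgn (x :: quaternion) = x /\<^sub>R norm x"
definition dist_quaternion_def: "dist (x :: quaternion) y = norm (x - y)"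
definition uniformity_quaternion_def [code del]:
  "(uniformity :: (quaternion \<times> quaternion) filter) =
     (INF e\<in>{0 <..}. principal {(x, y). dist x y < e})"
definition open_quaternion_def [code del]:
  "open (U :: quaternion set) \<longleftrightarrow>
     (\<forall>x\<in>U. eventually (\<lambda>(x', y). x' = x \<longrightarrow> y \<in> U) uniformity)"
definition "inverse x = inverse ((norm x)\<^sup>2) *\<^sub>R qcnj x"
definition divide_quaternion_def: "(x :: quaternion) div y = x * inverse y"

lemma norm_quaternion_square:
  "(norm x)\<^sup>2 = (qre x)\<^sup>2 + (qim1 x)\<^sup>2 + (qim2 x)\<^sup>2 + (qim3 x)\<^sup>2" for x :: quaternion
  by (simp add: norm_quaternion_def)

lemma norm_quaternion_eq_0_iff: "norm x = 0 \<longleftrightarrow> x = 0" for x :: quaternion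
proof -
  have "norm x = 0 \<longleftrightarrow> (qre x)\<^sup>2 + (qim1 x)\<^sup>2 + (qim2 x)\<^sup>2 + (qim3 x)\<^sup>2 = 0"
    by (simp add: norm_quaternion_def)
  also have "\<dots> \<longleftrightarrow> x = 0"
    by (simp add: add_nonneg_eq_0_iff quaternion_eq_iff zero_quaternion_def)
  finally show ?thesis .
qed

lemma quaternion_mult_cnj:
  "x * qcnj x = (norm x)\<^sup>2 *\<^sub>R 1" "qcnj x * x = (norm x)\<^sup>2 *\<^sub>R 1" for x :: quaternion
  unfolding norm_quaternion_square
  by (auto simp: qcnj_def scaleR_quaternion_def quaternion_ring_defs power2_eq_square)

instance
proof
  fix r :: real and x y :: quaternion and S :: "quaternion set"
  show "(norm x = 0) = (x = 0)"
    by (rule norm_quaternion_eq_0_iff)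
  have split: "norm z = sqrt ((sqrt ((qre z)\<^sup>2 + (qim1 z)\<^sup>2))\<^sup>2 + (sqrt ((qim2 z)\<^sup>2 + (qim3 z)\<^sup>2))\<^sup>2)"
    for z :: quaternion
    by (simp add: norm_quaternion_def add.assoc)
  have "norm (x + y) \<le> sqrt
      ((sqrt ((qre x)\<^sup>2 + (qim1 x)\<^sup>2) + sqrt ((qre y)\<^sup>2 + (qim1 y)\<^sup>2))\<^sup>2 +
       (sqrt ((qim2 x)\<^sup>2 + (qim3 x)\<^sup>2) + sqrt ((qim2 y)\<^sup>2 + (qim3 y)\<^sup>2))\<^sup>2)"
    unfolding split plus_quaternion_def quaternion.sel
    by (intro real_sqrt_le_mono add_mono power_mono real_sqrt_sum_squares_triangle_ineq) auto
  also have "\<dots> \<le> norm x + norm y"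
    unfolding split by (rule real_sqrt_sum_squares_triangle_ineq)
  finally show "norm (x + y) \<le> norm x + norm y" .
  have "(qre (scaleR r x))\<^sup>2 + (qim1 (scaleR r x))\<^sup>2 + (qim2 (scaleR r x))\<^sup>2 + (qim3 (scaleR r x))\<^sup>2
      = r\<^sup>2 * ((qre x)\<^sup>2 + (qim1 x)\<^sup>2 + (qim2 x)\<^sup>2 + (qim3 x)\<^sup>2)"
    by (simp add: scaleR_quaternion_def algebra_simps power2_eq_square)
  then show "norm (scaleR r x) = \<bar>r\<bar> * norm x"
    by (simp add: norm_quaternion_def real_sqrt_mult)
  show "norm (x * y) = norm x * norm y"
    by (simp add: norm_quaternion_def times_quaternion_def real_sqrt_mult [symmetric]
        power2_eq_square algebra_simps)
  show "inverse x * x = 1" "x * inverse x = 1" if "x \<noteq> 0"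
    using that by (simp_all add: inverse_quaternion_def quaternion_mult_cnj norm_quaternion_eq_0_iff)
  show "inverse (0 :: quaternion) = 0"
    by (simp add: inverse_quaternion_def norm_quaternion_eq_0_iff)
qed (rule sgn_quaternion_def dist_quaternion_def open_quaternion_def uniformity_quaternion_def
    divide_quaternion_def)+

end

section \<open>Quaternion matrices\<close>

type_synonym qvec = "quaternion vec"
type_synonym qmat = "quaternion mat"

definition qadjoint :: "qmat \<Rightarrow> qmat" where
  "qadjoint A = transpose_mat (map_mat qcnj A)"

definition is_qpinv :: "qmat \<Rightarrow> qmat \<Rightarrow> bool" where
  "is_qpinv A B \<longleftrightarrow> B \<in> carrier_mat (dim_col A) (dim_row A) \<and>
     A * B * A = A \<and> B * A * B = B \<and>
     qadjoint (A * B) = A * B \<and> qadjoint (B * A) = B * A"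

definition qpinv :: "qmat \<Rightarrow> qmat" where
  "qpinv A = (THE B. is_qpinv A B)"

definition qvec_norm :: "qvec \<Rightarrow> real" where
  "qvec_norm v = sqrt (\<Sum>i<dim_vec v. (norm (v $ i))\<^sup>2)"

text \<open>The unit sphere is compact, so the supremum is a maximum as soon as there is at least one
  column. A matrix without columns has no unit vector to range over; its norm is set to \<open>0\<close>.\<close>

definition spectral_norm :: "qmat \<Rightarrow> real" where
  "spectral_norm A =
     (if dim_col A = 0 then 0
      else SUP x \<in> {x \<in> carrier_vec (dim_col A). qvec_norm x = 1}. qvec_norm (A *\<^sub>v x))"

text \<open>Linear combinations are taken entrywise, because \<^typ>\<open>qvec\<close> contains vectors of all
  dimensions and hence is not an additive monoid. Scalars act on the right in \<open>right_lincomb\<close> and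
  on the left in \<open>left_lincomb\<close>.\<close>

definition right_lincomb :: "nat \<Rightarrow> (qvec \<Rightarrow> quaternion) \<Rightarrow> qvec set \<Rightarrow> qvec" where
  "right_lincomb d c F = vec d (\<lambda>i. \<Sum>v\<in>F. v $ i * c v)"

definition left_lincomb :: "nat \<Rightarrow> (qvec \<Rightarrow> quaternion) \<Rightarrow> qvec set \<Rightarrow> qvec" where
  "left_lincomb d c F = vec d (\<lambda>i. \<Sum>v\<in>F. c v * v $ i)"

definition right_span :: "nat \<Rightarrow> qvec set \<Rightarrow> qvec set" where
  "right_span d S = {right_lincomb d c F | c F. finite F \<and> F \<subseteq> S}"

definition left_span :: "nat \<Rightarrow> qvec set \<Rightarrow> qvec set" where
  "left_span d S = {left_lincomb d c F | c F. finite F \<and> F \<subseteq> S}"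

definition right_independent :: "nat \<Rightarrow> qvec set \<Rightarrow> bool" where
  "right_independent d S \<longleftrightarrow>
     (\<forall>F c. finite F \<longrightarrow> F \<subseteq> S \<longrightarrow> right_lincomb d c F = 0\<^sub>v d \<longrightarrow> (\<forall>v\<in>F. c v = 0))"

definition right_dim :: "nat \<Rightarrow> qvec set \<Rightarrow> nat" where
  "right_dim d U =
     card (SOME B. finite B \<and> B \<subseteq> U \<and> right_independent d B \<and> right_span d B = U)"

definition qcol_space :: "qmat \<Rightarrow> qvec set" where
  "qcol_space A = right_span (dim_row A) (set (cols A))"

definition qrow_space :: "qmat \<Rightarrow> qvec set" where
  "qrow_space A = left_span (dim_col A) (set (rows A))"

definition qrank :: "qmat \<Rightarrow> nat" where
  "qrank A = right_dim (dim_row A) (qcol_space A)"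

text \<open>The diagonal entries of \<open>S\<close> need not be prescribed further: the conditions below force
  \<open>X\<^sup>H X V = V S\<^sup>2\<close>, so they are exactly the positive singular values of \<open>X\<close> with multiplicity.
  They may be listed in any order.\<close>

definition truncated_qsvd :: "qmat \<Rightarrow> nat \<Rightarrow> qmat \<Rightarrow> qmat \<Rightarrow> qmat \<Rightarrow> bool" where
  "truncated_qsvd X k W S V \<longleftrightarrow>
     W \<in> carrier_mat (dim_row X) k \<and> V \<in> carrier_mat (dim_col X) k \<and> S \<in> carrier_mat k k \<and>
     qadjoint W * W = 1\<^sub>m k \<and> qadjoint V * V = 1\<^sub>m k \<and>
     (\<forall>i<k. \<forall>j<k. i \<noteq> j \<longrightarrow> S $$ (i, j) = 0) \<and>
     (\<forall>i<k. \<exists>s>0. S $$ (i, i) = of_real s) \<and>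
     X = W * S * qadjoint V"

end

theory Submission
  imports Defs "HOL-Analysis.L2_Norm"
begin

text \<open>
  Let \<open>P\<close> and \<open>Q\<close> be the orthogonal projections \<open>Ct Ct\<^sup>\<dagger>\<close> and \<open>Rt\<^sup>\<dagger> Rt\<close>. Then
  \<open>X - P Xt Q = (X - P X) + P (X - X Q) - P E Q\<close>. As \<open>X = C C\<^sup>\<dagger> X\<close>, \<open>C = Ct - EJ\<close> and \<open>P Ct = Ct\<close>, the
  first term equals \<open>- (1 - P) EJ C\<^sup>\<dagger> X\<close>; the second one is treated in the same way after taking
  adjoints. Projections are contractions, which gives the first bound even with \<open>\<parallel>E\<parallel>\<close> in place of
  \<open>3 \<parallel>E\<parallel>\<close>. The second bound follows from \<open>C\<^sup>\<dagger> X = (VJ\<^sup>H)\<^sup>\<dagger> V\<^sup>H\<close> and its analogue for rows.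
  Moore-Penrose inverses exist over the quaternions by Greville's recursion on the columns.
\<close>

section \<open>Conjugation on the quaternions\<close>

lemma qcnj_simps [simp]:
  "qcnj (qcnj x) = x" "qcnj 0 = 0" "qcnj 1 = 1" "qcnj (of_real r) = of_real r"
  "qcnj (x + y) = qcnj x + qcnj y" "qcnj (x - y) = qcnj x - qcnj y" "qcnj (- x) = - qcnj x"
  "qcnj (x * y) = qcnj y * qcnj x" "norm (qcnj x) = norm x"
  by (auto simp: qcnj_def quaternion_ring_defs quaternion_eq_iff of_real_def scaleR_quaternion_def
      norm_quaternion_def algebra_simps)

lemma qcnj_sum: "qcnj (sum f A) = (\<Sum>i\<in>A. qcnj (f i))"
  by (induction A rule: infinite_finite_induct) auto

lemma of_real_commute: "of_real r * (x :: quaternion) = x * of_real r"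
  by (simp add: of_real_def)

section \<open>Matrix algebra\<close>

lemma qadjoint_dim [simp]: "dim_row (qadjoint A) = dim_col A" "dim_col (qadjoint A) = dim_row A"
  by (simp_all add: qadjoint_def)

lemma qadjoint_carrier [simp]: "qadjoint A \<in> carrier_mat m n \<longleftrightarrow> A \<in> carrier_mat n m"
  unfolding carrier_mat_def mem_Collect_eq by auto

lemma qadjoint_index [simp]:
  "i < dim_col A \<Longrightarrow> j < dim_row A \<Longrightarrow> qadjoint A $$ (i, j) = qcnj (A $$ (j, i))"
  by (simp add: qadjoint_def)

lemma qadjoint_qadjoint [simp]: "qadjoint (qadjoint A) = A"
  by (rule eq_matI) auto

lemma qadjoint_one [simp]: "qadjoint (1\<^sub>m n) = 1\<^sub>m n"
  by (rule eq_matI) auto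

lemma qadjoint_zero: "qadjoint (0\<^sub>m m n) = 0\<^sub>m n m"
  by (rule eq_matI) auto

lemma qadjoint_add: "dim_row A = dim_row B \<Longrightarrow> dim_col A = dim_col B \<Longrightarrow>
    qadjoint (A + B) = qadjoint A + qadjoint B"
  by (rule eq_matI) auto

lemma qadjoint_minus: "dim_row A = dim_row B \<Longrightarrow> dim_col A = dim_col B \<Longrightarrow>
    qadjoint (A - B) = qadjoint A - qadjoint B"
  by (rule eq_matI) auto

text \<open>Transposition swaps the indices but leaves the factors of each entry in their old order;
  conjugation, an anti-automorphism, reverses that order too. Over the quaternions neither operation
  alone reverses products.\<close>

lemma qadjoint_mult: "dim_col A = dim_row B \<Longrightarrow> qadjoint (A * B) = qadjoint B * qadjoint A"
  by (rule eq_matI) (auto simp: scalar_prod_def qcnj_sum)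

text \<open>The side conditions of the library versions mention dimensions that do not occur in the
  rewritten term; in the following form the simplifier can discharge them.\<close>

lemma mat_mult_assoc: "dim_col A = dim_row B \<Longrightarrow> dim_col B = dim_row C \<Longrightarrow>
    A * B * C = A * (B * C)" for A :: "'a :: semiring_0 mat"
  by (rule assoc_mult_mat[of _ "dim_row A" "dim_col A" _ "dim_col B" _ "dim_col C"]) auto

lemma mat_add_mult: "dim_row A = dim_row B \<Longrightarrow> dim_col A = dim_row C \<Longrightarrow> dim_col B = dim_row C \<Longrightarrow>
    (A + B) * C = A * C + B * C" for A :: "'a :: semiring_0 mat"
  by (rule add_mult_distrib_mat[of _ "dim_row A" "dim_col A" _ _ "dim_col C"]) auto

lemma mat_mult_add: "dim_col C = dim_row A \<Longrightarrow> dim_col C = dim_row B \<Longrightarrow> dim_col A = dim_col B \<Longrightarrow>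
    C * (A + B) = C * A + C * B" for A :: "'a :: semiring_0 mat"
  by (rule mult_add_distrib_mat[of _ "dim_row C" "dim_col C" _ "dim_col A"]) auto

lemma mat_minus_mult: "dim_row A = dim_row B \<Longrightarrow> dim_col A = dim_row C \<Longrightarrow> dim_col B = dim_row C \<Longrightarrow>
    (A - B) * C = A * C - B * C" for A :: "'a :: ring mat"
  by (rule minus_mult_distrib_mat[of _ "dim_row A" "dim_col A" _ _ "dim_col C"]) auto

lemma mat_mult_minus: "dim_col C = dim_row A \<Longrightarrow> dim_col C = dim_row B \<Longrightarrow> dim_col A = dim_col B \<Longrightarrow>
    C * (A - B) = C * A - C * B" for A :: "'a :: ring mat"
  by (rule mult_minus_distrib_mat[of _ "dim_row C" "dim_col C" _ "dim_col A"]) auto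

lemma mat_zero_simps:
  fixes A :: "'a :: ring mat"
  shows "dim_row A = k \<Longrightarrow> 0\<^sub>m r k * A = 0\<^sub>m r (dim_col A)"
    and "dim_col A = k \<Longrightarrow> A * 0\<^sub>m k r = 0\<^sub>m (dim_row A) r"
    and "dim_row A = r \<Longrightarrow> dim_col A = k \<Longrightarrow> A + 0\<^sub>m r k = A"
    and "dim_row A = r \<Longrightarrow> dim_col A = k \<Longrightarrow> 0\<^sub>m r k + A = A"
    and "dim_row A = r \<Longrightarrow> dim_col A = k \<Longrightarrow> A - 0\<^sub>m r k = A"
    and "dim_row A = r \<Longrightarrow> dim_col A = k \<Longrightarrow> A - A = 0\<^sub>m r k"
  by (auto intro!: eq_matI)

lemmas mat_ring_simps = mat_mult_assoc mat_add_mult mat_mult_add mat_minus_mult mat_mult_minus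
lemmas qadjoint_simps = qadjoint_add qadjoint_minus qadjoint_mult

section \<open>Existence and uniqueness of the Moore-Penrose inverse\<close>

text \<open>Penrose's argument: \<open>A * B\<close> and \<open>A * C\<close> are Hermitian
  projections onto the same range, hence equal, and likewise \<open>B * A = C * A\<close>. Then
  \<open>B = B A B = B A C = C A C = C\<close>.\<close>

lemma is_qpinv_unique:
  assumes "is_qpinv A B" "is_qpinv A C"
  shows "B = C"
proof -
  have dims [simp]: "dim_row B = dim_col A" "dim_col B = dim_row A"
    "dim_row C = dim_col A" "dim_col C = dim_row A"
    and B: "A * B * A = A" "B * A * B = B" "qadjoint (A * B) = A * B" "qadjoint (B * A) = B * A"
    and C: "A * C * A = A" "C * A * C = C" "qadjoint (A * C) = A * C" "qadjoint (C * A) = C * A"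
    using assms by (auto simp: is_qpinv_def)
  have "A * B = (A * C) * (A * B)"
    by (simp flip: mat_mult_assoc add: C)
  \<comment> \<open>Both factors are Hermitian, so the adjoint only swaps them; in the swapped order
    \<open>A * B * A = A\<close> collapses the product to \<open>A * C\<close>.\<close>
  also have "\<dots> = qadjoint ((A * B) * (A * C))"
    by (subst qadjoint_mult) (simp_all add: B C)
  also have "(A * B) * (A * C) = A * C"
    by (simp flip: mat_mult_assoc add: B)
  finally have AB: "A * B = A * C" by (simp add: C)
  have "B * A = (B * A) * (C * A)"
    using C(1) by (simp add: mat_mult_assoc)
  also have "\<dots> = qadjoint ((C * A) * (B * A))"
    by (subst qadjoint_mult) (simp_all add: B C)
  also have "(C * A) * (B * A) = C * A"
    using B(1) by (simp add: mat_mult_assoc)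
  finally have BA: "B * A = C * A" by (simp add: C)
  have "B = B * (A * C)"
    using B(2) AB by (simp add: mat_mult_assoc)
  also have "\<dots> = C * A * C"
    by (simp flip: mat_mult_assoc add: BA)
  finally show ?thesis
    by (simp add: C)
qed

text \<open>Here \<open>qadjoint c * c\<close> is the real number \<open>s\<close>, the squared
  length of \<open>c\<close>, and \<open>T\<close> is its inverse; \<open>T * qadjoint c\<close>
  will serve as the pseudoinverse of the column \<open>c\<close>.\<close>

lemma column_qpinv:
  assumes c: "c \<in> carrier_mat m 1"
  obtains T where "T \<in> carrier_mat 1 1" "qadjoint T = T" "c * (T * (qadjoint c * c)) = c"
proof -
  define s where "s = (\<Sum>i<m. (norm (c $$ (i, 0)))\<^sup>2)"
  \<comment> \<open>For \<open>c = 0\<close> the convention \<open>inverse 0 = 0\<close> gives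
    \<open>T = 0\<close>, so the zero column fits the same formula.\<close>
  define T where "T = mat 1 1 (\<lambda>_. of_real (inverse s) :: quaternion)"
  have N: "qadjoint c * c = mat 1 1 (\<lambda>_. of_real s)"
    using c by (intro eq_matI)
      (auto simp: scalar_prod_def s_def quaternion_mult_cnj of_real_def scaleR_sum_left
        lessThan_atLeast0)
  have "c * (T * (qadjoint c * c)) = c"
  proof (cases "s = 0")
    case True
    then have "c = 0\<^sub>m m 1"
      using c by (intro eq_matI) (auto simp: s_def sum_nonneg_eq_0_iff)
    then show ?thesis
      by (auto simp: T_def)
  next
    case False
    then have "T * (qadjoint c * c) = 1\<^sub>m 1"
      unfolding N T_def
      by (intro eq_matI) (auto simp: scalar_prod_def simp flip: of_real_mult)
    then show ?thesis
      using c by simp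
  qed
  then show ?thesis
    by (intro that[of T]) (auto simp: T_def simp del: of_real_inverse intro!: eq_matI)
qed

text \<open>One step of Greville's column recursion: the column \<open>a\<close> is written into the zero column of
  \<open>A\<close> selected by the unit vector \<open>e\<close>. The new range projection is \<open>P + c d\<close>, where \<open>P = A B\<close> is the
  old one, \<open>c = a - P a\<close>, and \<open>d\<close> is the pseudoinverse of the column \<open>c\<close>.\<close>

lemma hermitian_inner_inverse_step:
  assumes A: "A \<in> carrier_mat m n" and B: "B \<in> carrier_mat n m"
    and ABA: "A * B * A = A" and herm: "qadjoint (A * B) = A * B"
    and e: "e \<in> carrier_mat n 1" "A * e = 0\<^sub>m m 1" "qadjoint e * e = 1\<^sub>m 1"
    and a: "a \<in> carrier_mat m 1"
  obtains B' where "B' \<in> carrier_mat n m"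
    "(A + a * qadjoint e) * B' * (A + a * qadjoint e) = A + a * qadjoint e"
    "qadjoint ((A + a * qadjoint e) * B') = (A + a * qadjoint e) * B'"
proof -
  have [simp]: "dim_row A = m" "dim_col A = n" "dim_row B = n" "dim_col B = m"
    "dim_row e = n" "dim_col e = 1" "dim_row a = m" "dim_col a = 1"
    using assms by auto
  define P where "P = A * B"
  \<comment> \<open>The component of \<open>B\<close> along \<open>e\<close> is removed:
    \<open>qadjoint e * B1\<close> vanishes, while \<open>A * B1 = A * B\<close> because
    \<open>A * e = 0\<close>.\<close>
  define B1 where "B1 = B - e * (qadjoint e * B)"
  define c where "c = a - P * a"
  have dims [simp]: "dim_row P = m" "dim_col P = m" "dim_row B1 = n" "dim_col B1 = m"
    "dim_row c = m" "dim_col c = 1"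
    by (simp_all add: P_def B1_def c_def)
  have Ae: "A * (e * Z) = 0\<^sub>m m (dim_col Z)" if "dim_row Z = 1" for Z
  proof -
    have "A * (e * Z) = A * e * Z"
      using that by (simp add: mat_mult_assoc)
    then show ?thesis
      using that by (simp add: e mat_zero_simps)
  qed
  have AB1: "A * B1 = P"
    unfolding B1_def by (simp add: mat_mult_minus Ae P_def mat_zero_simps)
  have eB1: "qadjoint e * B1 = 0\<^sub>m 1 m"
  proof -
    have "qadjoint e * (e * (qadjoint e * B)) = qadjoint e * e * (qadjoint e * B)"
      by (simp add: mat_mult_assoc)
    then show ?thesis
      unfolding B1_def by (simp add: mat_mult_minus e mat_zero_simps)
  qed
  have PA: "P * A = A" and PP: "P * P = P" and PH: "qadjoint P = P"
    using ABA herm by (simp_all add: P_def flip: mat_mult_assoc)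
  have Pc: "P * c = 0\<^sub>m m 1"
  proof -
    have "P * (P * a) = P * a"
      by (simp flip: mat_mult_assoc add: PP)
    then show ?thesis
      unfolding c_def by (simp add: mat_mult_minus mat_zero_simps)
  qed
  \<comment> \<open>The new direction \<open>c\<close> is orthogonal to the range of
    \<open>P\<close>. Hence \<open>d\<close> annihilates that range, and adding \<open>c * d\<close>
    to \<open>P\<close> does not disturb the old columns.\<close>
  have cP: "qadjoint c * P = 0\<^sub>m 1 m"
  proof -
    have "qadjoint c * P = qadjoint (P * c)"
      by (simp add: qadjoint_mult PH)
    then show ?thesis
      unfolding Pc by (simp add: qadjoint_zero)
  qed
  have "c \<in> carrier_mat m 1"
    by (intro carrier_matI) simp_all
  then obtain T where T: "T \<in> carrier_mat 1 1" "qadjoint T = T" "c * (T * (qadjoint c * c)) = c"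
    by (rule column_qpinv)
  define d where "d = T * qadjoint c"
  have [simp]: "dim_row T = 1" "dim_col T = 1" "dim_row d = 1" "dim_col d = m"
    using T by (auto simp: d_def)
  have dP: "d * P = 0\<^sub>m 1 m"
    by (simp add: d_def mat_mult_assoc cP mat_zero_simps)
  have dA: "d * A = 0\<^sub>m 1 n"
  proof -
    have "d * A = d * P * A" by (simp add: mat_mult_assoc PA)
    then show ?thesis by (simp add: dP mat_zero_simps)
  qed
  have cdH: "qadjoint (c * d) = c * d"
    by (simp add: d_def qadjoint_mult T mat_mult_assoc)
  have cda: "c * (d * a) = c"
  proof -
    have "a = c + P * a"
      by (rule eq_matI) (auto simp: c_def simp del: index_mult_mat(1))
    then have "d * a = d * (c + P * a)" by simp
    also have "\<dots> = d * c + d * P * a"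
      by (simp add: mat_mult_add mat_mult_assoc)
    also have "\<dots> = d * c"
      by (simp add: dP mat_zero_simps)
    finally show ?thesis
      by (simp add: d_def mat_mult_assoc T)
  qed
  \<comment> \<open>Greville's update: the component along \<open>e\<close> becomes
    \<open>d\<close>, and subtracting \<open>B1 * (a * d)\<close> compensates for it, so that the
    product with the enlarged matrix is \<open>P + (a - P * a) * d = P + c * d\<close>.\<close>
  define B' where "B' = B1 - B1 * (a * d) + e * d"
  have [simp]: "dim_row B' = n" "dim_col B' = m" by (simp_all add: B'_def)
  have "A * B' = P - P * (a * d)"
  proof -
    have "A * (B1 * (a * d)) = A * B1 * (a * d)"
      by (simp add: mat_mult_assoc)
    then show ?thesis
      by (simp add: B'_def mat_mult_add mat_mult_minus Ae AB1 mat_zero_simps)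
  qed
  moreover have "qadjoint e * B' = d"
  proof -
    have "qadjoint e * B' = qadjoint e * B1 - qadjoint e * B1 * (a * d) + qadjoint e * e * d"
      by (simp add: B'_def mat_ring_simps)
    then show ?thesis
      unfolding eB1 e(3) by (simp add: mat_zero_simps)
  qed
  ultimately have "(A + a * qadjoint e) * B' = P - P * (a * d) + a * d"
    by (simp add: mat_add_mult mat_mult_assoc)
  also have "\<dots> = P + (a * d - P * (a * d))"
    by (rule eq_matI) (auto simp del: index_mult_mat(1))
  finally have AB': "(A + a * qadjoint e) * B' = P + c * d"
    by (simp add: c_def mat_minus_mult mat_mult_assoc)
  have "(P + c * d) * (A + a * qadjoint e)
      = P * A + c * (d * A) + (P * a * qadjoint e + c * (d * a) * qadjoint e)"
    by (simp add: mat_ring_simps)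
  also have "\<dots> = A + (P * a + c) * qadjoint e"
    unfolding PA dA cda by (simp add: mat_ring_simps mat_zero_simps)
  also have "P * a + c = a"
    by (rule eq_matI) (auto simp: c_def simp del: index_mult_mat(1))
  finally show ?thesis
    by (intro that[of B']) (auto simp: AB' qadjoint_add PH cdH)
qed

text \<open>Induction on the number of columns. The recursion carries only two of the Penrose
  equations; the other two are obtained afterwards by combining \<open>A\<close> with its
  adjoint.\<close>

lemma hermitian_inner_inverse_exists:
  assumes "A \<in> carrier_mat m n"
  shows "\<exists>B \<in> carrier_mat n m. A * B * A = A \<and> qadjoint (A * B) = A * B"
proof -
  \<comment> \<open>Columns from \<open>r\<close> on are replaced by zero instead of being cut off.
    All truncations thus have the same size, and restoring column \<open>r\<close> amounts to adding
    \<open>a * qadjoint e\<close>.\<close>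
  define t where "t r = mat m n (\<lambda>(i, j). if j < r then A $$ (i, j) else 0)" for r
  have t_dim [simp]: "dim_row (t r) = m" "dim_col (t r) = n" for r
    by (simp_all add: t_def)
  have "\<exists>B \<in> carrier_mat n m. t r * B * t r = t r \<and> qadjoint (t r * B) = t r * B"
    if "r \<le> n" for r
    using that
  proof (induction r)
    case 0
    have "t 0 = 0\<^sub>m m n" by (auto simp: t_def)
    then show ?case
      by (intro bexI[of _ "0\<^sub>m n m"]) (auto simp: mat_zero_simps qadjoint_zero)
  next
    case (Suc r)
    then obtain B where B: "B \<in> carrier_mat n m" "t r * B * t r = t r"
      "qadjoint (t r * B) = t r * B" by auto
    define e where "e = mat n 1 (\<lambda>(i, _). if i = r then 1 else 0 :: quaternion)"
    define a where "a = mat m 1 (\<lambda>(i, _). A $$ (i, r))"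
    have [simp]: "dim_row e = n" "dim_col e = 1" "dim_row a = m" "dim_col a = 1"
      by (simp_all add: e_def a_def)
    have te: "t r * e = 0\<^sub>m m 1"
      by (auto intro!: eq_matI sum.neutral simp: scalar_prod_def t_def e_def)
    have ee: "qadjoint e * e = 1\<^sub>m 1"
    proof (rule eq_matI)
      fix i j assume "i < dim_row (1\<^sub>m 1 :: qmat)" "j < dim_col (1\<^sub>m 1 :: qmat)"
      moreover have "(\<Sum>i = 0..<n. qcnj (if i = r then 1 else 0) * (if i = r then 1 else 0)) = 1"
        using Suc.prems by (simp add: if_distrib[of "\<lambda>x. _ * x"] cong: if_cong)
      ultimately show "(qadjoint e * e) $$ (i, j) = 1\<^sub>m 1 $$ (i, j)"
        by (simp add: scalar_prod_def e_def)
    qed auto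
    have "t r \<in> carrier_mat m n" "e \<in> carrier_mat n 1" "a \<in> carrier_mat m 1"
      by (intro carrier_matI; simp)+
    then obtain B' where "B' \<in> carrier_mat n m"
      "(t r + a * qadjoint e) * B' * (t r + a * qadjoint e) = t r + a * qadjoint e"
      "qadjoint ((t r + a * qadjoint e) * B') = (t r + a * qadjoint e) * B'"
      using hermitian_inner_inverse_step[OF _ B _ te ee] by blast
    moreover have "t r + a * qadjoint e = t (Suc r)"
      by (rule eq_matI) (auto simp: t_def a_def e_def scalar_prod_def less_Suc_eq)
    ultimately show ?case by auto
  qed
  moreover have "t n = A"
    using assms by (intro eq_matI) (auto simp: t_def)
  ultimately show ?thesis by blast
qed

text \<open>Urquhart's formula: \<open>G\<close> is an inner inverse with \<open>A G\<close>
  Hermitian, and \<open>L\<close>, the adjoint of such an inverse of \<open>A^H\<close>, is an inner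
  inverse with \<open>L A\<close> Hermitian. For \<open>B = L A G\<close> this gives
  \<open>A B = A G\<close> and \<open>B A = L A\<close>.\<close>

lemma is_qpinv_exists: "\<exists>B. is_qpinv A B"
proof -
  obtain G where G: "G \<in> carrier_mat (dim_col A) (dim_row A)" "A * G * A = A"
    "qadjoint (A * G) = A * G"
    using hermitian_inner_inverse_exists[of A "dim_row A" "dim_col A"] by auto
  obtain K where K: "K \<in> carrier_mat (dim_row A) (dim_col A)"
    "qadjoint A * K * qadjoint A = qadjoint A" "qadjoint (qadjoint A * K) = qadjoint A * K"
    using hermitian_inner_inverse_exists[of "qadjoint A" "dim_col A" "dim_row A"] by auto
  define L where "L = qadjoint K"
  have [simp]: "dim_row G = dim_col A" "dim_col G = dim_row A"
    "dim_row L = dim_col A" "dim_col L = dim_row A" "dim_row K = dim_row A" "dim_col K = dim_col A"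
    using G K by (auto simp: L_def)
  have ALA: "A * L * A = A"
    using arg_cong[OF K(2), of qadjoint] by (simp add: L_def qadjoint_mult mat_mult_assoc)
  have LA: "qadjoint (L * A) = L * A"
    using K(3) by (simp add: L_def qadjoint_mult)
  define B where "B = L * A * G"
  have [simp]: "dim_row B = dim_col A" "dim_col B = dim_row A" by (simp_all add: B_def)
  have AB: "A * B = A * G"
    by (simp add: B_def flip: mat_mult_assoc add: ALA)
  have BA: "B * A = L * A"
    using G(2) by (simp add: B_def mat_mult_assoc)
  have "B * A * B = L * (A * B)" by (simp add: BA mat_mult_assoc)
  also have "\<dots> = B" unfolding AB by (simp add: B_def mat_mult_assoc)
  finally have "is_qpinv A B"
    unfolding is_qpinv_def by (auto simp: AB BA G LA intro!: carrier_matI)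
  then show ?thesis ..
qed

lemma qpinv: "is_qpinv A (qpinv A)"
  unfolding qpinv_def using is_qpinv_exists is_qpinv_unique by (metis theI)

lemma qpinv_eqI: "is_qpinv A B \<Longrightarrow> qpinv A = B"
  using is_qpinv_unique qpinv by blast

lemma qpinv_dim [simp]: "dim_row (qpinv A) = dim_col A" "dim_col (qpinv A) = dim_row A"
  using qpinv[of A] by (auto simp: is_qpinv_def)

text \<open>The adjoint keeps the form of the first two Penrose equations and swaps the last two.
  Row statements can thereby be deduced from their column versions.\<close>

lemma qpinv_qadjoint: "qpinv (qadjoint A) = qadjoint (qpinv A)"
proof (rule qpinv_eqI)
  have *: "A * qpinv A * A = A" "qpinv A * A * qpinv A = qpinv A"
    "qadjoint (A * qpinv A) = A * qpinv A" "qadjoint (qpinv A * A) = qpinv A * A"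
    using qpinv[of A] by (auto simp: is_qpinv_def)
  have "qadjoint A * qadjoint (qpinv A) * qadjoint A = qadjoint A"
    using arg_cong[OF *(1), of qadjoint] by (simp add: qadjoint_mult mat_mult_assoc)
  moreover have "qadjoint (qpinv A) * qadjoint A * qadjoint (qpinv A) = qadjoint (qpinv A)"
    using arg_cong[OF *(2), of qadjoint] by (simp add: qadjoint_mult mat_mult_assoc)
  moreover have "qadjoint (qadjoint A * qadjoint (qpinv A)) = qadjoint A * qadjoint (qpinv A)"
    "qadjoint (qadjoint (qpinv A) * qadjoint A) = qadjoint (qpinv A) * qadjoint A"
    using *(3,4) by (simp_all add: qadjoint_mult)
  ultimately show "is_qpinv (qadjoint A) (qadjoint (qpinv A))"
    by (auto simp: is_qpinv_def intro!: carrier_matI)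
qed

section \<open>The spectral norm\<close>

text \<open>The product \<open>x^H y\<close>. With the conjugate in the left factor it is right
  linear in \<open>y\<close>, which suits matrices acting from the left.\<close>

definition qinner :: "qvec \<Rightarrow> qvec \<Rightarrow> quaternion" where
  "qinner x y = (\<Sum>i<dim_vec x. qcnj (x $ i) * y $ i)"

lemma qvec_norm_L2: "qvec_norm v = L2_set (\<lambda>i. norm (v $ i)) {..<dim_vec v}"
  by (simp add: qvec_norm_def L2_set_def)

lemma qvec_norm_nonneg [simp]: "0 \<le> qvec_norm v"
  by (simp add: qvec_norm_L2)

lemma qvec_norm_triangle:
  assumes "dim_vec x = dim_vec y"
  shows "qvec_norm (x + y) \<le> qvec_norm x + qvec_norm y"
proof -
  have "qvec_norm (x + y) \<le> L2_set (\<lambda>i. norm (x $ i) + norm (y $ i)) {..<dim_vec y}"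
    unfolding qvec_norm_L2 using assms by (auto intro!: L2_set_mono norm_triangle_ineq)
  also have "\<dots> \<le> qvec_norm x + qvec_norm y"
    unfolding qvec_norm_L2 assms by (rule L2_set_triangle_ineq)
  finally show ?thesis .
qed

lemma qvec_norm_smult: "qvec_norm (of_real r \<cdot>\<^sub>v x) = \<bar>r\<bar> * qvec_norm x"
  by (simp add: qvec_norm_L2 L2_set_right_distrib) (auto simp: norm_mult intro!: L2_set_cong)

lemma qvec_norm_eq_0: "qvec_norm x = 0 \<Longrightarrow> x = 0\<^sub>v (dim_vec x)"
  by (intro eq_vecI) (auto simp: qvec_norm_L2 L2_set_eq_0_iff)

lemma qinner_self: "qinner x x = of_real ((qvec_norm x)\<^sup>2)"
  by (simp add: qinner_def qvec_norm_def quaternion_mult_cnj of_real_def sum_nonneg scaleR_sum_left)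

lemma qinner_cauchy_schwarz:
  assumes "dim_vec x = dim_vec y"
  shows "norm (qinner x y) \<le> qvec_norm x * qvec_norm y"
proof -
  have "norm (qinner x y) \<le> (\<Sum>i<dim_vec x. \<bar>norm (x $ i)\<bar> * \<bar>norm (y $ i)\<bar>)"
    unfolding qinner_def by (rule order_trans[OF norm_sum]) (simp add: norm_mult)
  also have "\<dots> \<le> qvec_norm x * qvec_norm y"
    unfolding qvec_norm_L2 assms[symmetric] by (rule L2_set_mult_ineq)
  finally show ?thesis .
qed

text \<open>Both sides are \<open>x^H A^H y\<close> as a double sum; the factors keep their order
  and only the summations are exchanged.\<close>

lemma qinner_adjoint:
  assumes "dim_vec x = dim_col A" "dim_vec y = dim_row A"
  shows "qinner (A *\<^sub>v x) y = qinner x (qadjoint A *\<^sub>v y)"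
proof -
  have "qinner (A *\<^sub>v x) y
      = (\<Sum>i<dim_row A. \<Sum>j<dim_col A. qcnj (x $ j) * (qcnj (A $$ (i, j)) * y $ i))"
    using assms by (simp add: qinner_def scalar_prod_def qcnj_sum sum_distrib_right mult.assoc
        lessThan_atLeast0)
  also have "\<dots> = qinner x (qadjoint A *\<^sub>v y)"
    using assms by (subst sum.swap)
      (simp add: qinner_def scalar_prod_def sum_distrib_left lessThan_atLeast0)
  finally show ?thesis .
qed

text \<open>The sum of all entry norms is a crude constant, but it serves only to bound the supremum
  in \<open>spectral_norm\<close>.\<close>

lemma qvec_norm_mult_bound: "\<exists>K. \<forall>x. dim_vec x = dim_col A \<longrightarrow> qvec_norm (A *\<^sub>v x) \<le> K * qvec_norm x"
proof (intro exI allI impI)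
  fix x :: qvec assume x: "dim_vec x = dim_col A"
  have le: "norm (x $ j) \<le> qvec_norm x" if "j < dim_col A" for j
    unfolding qvec_norm_L2 using that x by (intro member_le_L2_set) auto
  have "qvec_norm (A *\<^sub>v x) \<le> (\<Sum>i<dim_row A. norm ((A *\<^sub>v x) $ i))"
    unfolding qvec_norm_L2 by (rule order_trans[OF L2_set_le_sum]) auto
  also have "\<dots> \<le> (\<Sum>i<dim_row A. \<Sum>j<dim_col A. norm (A $$ (i, j)) * qvec_norm x)"
  proof (intro sum_mono)
    fix i assume "i \<in> {..<dim_row A}"
    then have "norm ((A *\<^sub>v x) $ i) = norm (\<Sum>j<dim_col A. A $$ (i, j) * x $ j)"
      using x by (simp add: scalar_prod_def lessThan_atLeast0)
    also have "\<dots> \<le> (\<Sum>j<dim_col A. norm (A $$ (i, j)) * qvec_norm x)"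
      by (intro sum_norm_le) (auto simp: norm_mult le intro!: mult_left_mono)
    finally show "norm ((A *\<^sub>v x) $ i) \<le> (\<Sum>j<dim_col A. norm (A $$ (i, j)) * qvec_norm x)" .
  qed
  finally show "qvec_norm (A *\<^sub>v x) \<le> (\<Sum>i<dim_row A. \<Sum>j<dim_col A. norm (A $$ (i, j))) * qvec_norm x"
    by (simp add: sum_distrib_right)
qed

lemma unit_qvec_exists:
  assumes "n \<noteq> 0"
  shows "\<exists>x \<in> carrier_vec n. qvec_norm x = 1"
proof
  have "(\<Sum>i<n. (norm (unit_vec n 0 $ i :: quaternion))\<^sup>2) = (\<Sum>i<n. if i = 0 then 1 else 0)"
    by (rule sum.cong) auto
  then show "qvec_norm (unit_vec n 0) = 1"
    using assms by (simp add: qvec_norm_def)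
qed simp

section \<open>The spectral norm as an operator norm\<close>

lemma spectral_norm_bdd:
  "bdd_above ((\<lambda>x. qvec_norm (A *\<^sub>v x)) ` {x \<in> carrier_vec (dim_col A). qvec_norm x = 1})"
proof -
  obtain K where "\<And>x. dim_vec x = dim_col A \<Longrightarrow> qvec_norm (A *\<^sub>v x) \<le> K * qvec_norm x"
    using qvec_norm_mult_bound by blast
  then show ?thesis
    by (intro bdd_aboveI2[where M = K]) (metis (mono_tags, lifting) carrier_vecD mem_Collect_eq mult.right_neutral)
qed

lemma spectral_norm_nonneg [simp]: "0 \<le> spectral_norm A"
proof (cases "dim_col A = 0")
  case False
  then obtain x where x: "x \<in> carrier_vec (dim_col A)" "qvec_norm x = 1"
    using unit_qvec_exists by blast
  have "0 \<le> qvec_norm (A *\<^sub>v x)" by simp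
  also have "\<dots> \<le> spectral_norm A"
    using False x spectral_norm_bdd[of A] by (auto simp: spectral_norm_def intro!: cSUP_upper)
  finally show ?thesis .
qed (simp add: spectral_norm_def)

text \<open>Left scaling passes through \<open>A\<close> here because real scalars are central; they
  are all that normalising a vector requires.\<close>

lemma mult_mat_vec_of_real:
  "dim_vec x = dim_col A \<Longrightarrow> A *\<^sub>v (of_real r \<cdot>\<^sub>v x) = of_real r \<cdot>\<^sub>v (A *\<^sub>v x)" for A :: qmat
  by (rule eq_vecI)
    (auto simp: scalar_prod_def sum_distrib_left of_real_commute mult.assoc intro!: sum.cong)

text \<open>Normalising reduces the claim to unit vectors. Vectors of norm zero are treated apart,
  which also settles matrices without columns, whose norm is not given by the supremum.\<close>

lemma spectral_norm_bound:
  assumes "dim_vec x = dim_col A"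
  shows "qvec_norm (A *\<^sub>v x) \<le> spectral_norm A * qvec_norm x"
proof (cases "qvec_norm x = 0")
  case True
  then have "x = of_real 0 \<cdot>\<^sub>v x"
    using qvec_norm_eq_0[OF True] by (intro eq_vecI) (auto, metis index_zero_vec(1))
  then have "A *\<^sub>v x = of_real 0 \<cdot>\<^sub>v (A *\<^sub>v x)"
    using assms mult_mat_vec_of_real by metis
  then have "qvec_norm (A *\<^sub>v x) = 0"
    using qvec_norm_smult[of 0] by (metis abs_0 mult_zero_left)
  then show ?thesis by simp
next
  case False
  have dc: "dim_col A \<noteq> 0"
    using False assms by (intro notI) (simp add: qvec_norm_def)
  define u where "u = of_real (inverse (qvec_norm x)) \<cdot>\<^sub>v x"
  have u: "u \<in> carrier_vec (dim_col A)" "qvec_norm u = 1"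
    unfolding u_def qvec_norm_smult using False assms by (auto intro: carrier_vecI)
  have "qvec_norm (A *\<^sub>v u) \<le> spectral_norm A"
    using dc u spectral_norm_bdd[of A] by (auto simp: spectral_norm_def intro!: cSUP_upper)
  moreover have "qvec_norm (A *\<^sub>v u) = inverse (qvec_norm x) * qvec_norm (A *\<^sub>v x)"
    unfolding u_def using assms
    by (simp only: mult_mat_vec_of_real qvec_norm_smult) simp
  ultimately show ?thesis
    using False qvec_norm_nonneg[of x] by (simp add: field_simps)
qed

text \<open>The condition \<open>0 \<le> c\<close> settles matrices without columns, whose norm is
  \<open>0\<close>; otherwise the unit sphere is nonempty and the supremum is at most
  \<open>c\<close>.\<close>

lemma spectral_norm_leI:
  assumes "\<And>x. dim_vec x = dim_col A \<Longrightarrow> qvec_norm (A *\<^sub>v x) \<le> c * qvec_norm x" "0 \<le> c"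
  shows "spectral_norm A \<le> c"
proof (cases "dim_col A = 0")
  case False
  then have "{x \<in> carrier_vec (dim_col A). qvec_norm x = 1} \<noteq> {}"
    using unit_qvec_exists by auto
  moreover have "qvec_norm (A *\<^sub>v x) \<le> c"
    if "x \<in> {x \<in> carrier_vec (dim_col A). qvec_norm x = 1}" for x
    using assms(1)[of x] that by simp
  ultimately show ?thesis
    using False by (simp only: spectral_norm_def if_False) (rule cSUP_least)
qed (use assms in \<open>simp add: spectral_norm_def\<close>)

lemma spectral_norm_mult:
  assumes "dim_col A = dim_row B"
  shows "spectral_norm (A * B) \<le> spectral_norm A * spectral_norm B"
proof (rule spectral_norm_leI)
  fix x :: qvec assume x: "dim_vec x = dim_col (A * B)"
  have "A * B *\<^sub>v x = A *\<^sub>v (B *\<^sub>v x)"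
    using assms x by (intro assoc_mult_mat_vec[of _ "dim_row A" "dim_col A" _ "dim_col B"])
      (auto intro!: carrier_vecI carrier_matI)
  moreover have "qvec_norm (A *\<^sub>v (B *\<^sub>v x)) \<le> spectral_norm A * qvec_norm (B *\<^sub>v x)"
    using assms by (intro spectral_norm_bound) auto
  moreover have "qvec_norm (B *\<^sub>v x) \<le> spectral_norm B * qvec_norm x"
    using x by (intro spectral_norm_bound) auto
  ultimately show "qvec_norm (A * B *\<^sub>v x) \<le> spectral_norm A * spectral_norm B * qvec_norm x"
    by (metis mult.assoc mult_left_mono order_trans spectral_norm_nonneg)
qed simp

lemma spectral_norm_add:
  assumes "dim_row A = dim_row B" "dim_col A = dim_col B"
  shows "spectral_norm (A + B) \<le> spectral_norm A + spectral_norm B"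
proof (rule spectral_norm_leI)
  fix x :: qvec assume x: "dim_vec x = dim_col (A + B)"
  have "(A + B) *\<^sub>v x = A *\<^sub>v x + B *\<^sub>v x"
    using assms x by (intro add_mult_distrib_mat_vec[of _ "dim_row A" "dim_col A"])
      (auto intro!: carrier_vecI carrier_matI)
  moreover have "qvec_norm (A *\<^sub>v x + B *\<^sub>v x) \<le> qvec_norm (A *\<^sub>v x) + qvec_norm (B *\<^sub>v x)"
    using assms by (intro qvec_norm_triangle) auto
  moreover have "qvec_norm (A *\<^sub>v x) \<le> spectral_norm A * qvec_norm x"
    "qvec_norm (B *\<^sub>v x) \<le> spectral_norm B * qvec_norm x"
    using x assms by (auto intro!: spectral_norm_bound)
  ultimately show "qvec_norm ((A + B) *\<^sub>v x) \<le> (spectral_norm A + spectral_norm B) * qvec_norm x"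
    by (simp add: algebra_simps)
qed simp

lemma spectral_norm_uminus: "spectral_norm (- A) = spectral_norm A"
proof -
  have "qvec_norm (- A *\<^sub>v x) = qvec_norm (A *\<^sub>v x)" if "dim_vec x = dim_col A" for x
    using that by (auto simp: qvec_norm_L2 scalar_prod_def sum_negf intro!: L2_set_cong)
  then show ?thesis
    by (auto simp: spectral_norm_def intro!: SUP_cong)
qed

lemma spectral_norm_minus:
  assumes "dim_row A = dim_row B" "dim_col A = dim_col B"
  shows "spectral_norm (A - B) \<le> spectral_norm A + spectral_norm B"
proof -
  have "A - B = A + - B" using assms by (intro eq_matI) auto
  then show ?thesis
    using spectral_norm_add[of A "- B"] assms by (simp add: spectral_norm_uminus)
qed

text \<open>With \<open>z = A^H y\<close> one has \<open>|z|^2 = <y, A z> \<le> |y| |A| |z|\<close>,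
  and \<open>|z|\<close> cancels unless it is zero.\<close>

lemma spectral_norm_qadjoint_le: "spectral_norm (qadjoint A) \<le> spectral_norm A"
proof (rule spectral_norm_leI)
  fix y :: qvec assume y: "dim_vec y = dim_col (qadjoint A)"
  define z where "z = qadjoint A *\<^sub>v y"
  have z: "dim_vec z = dim_col A" by (simp add: z_def)
  have "(qvec_norm z)\<^sup>2 = norm (qinner z z)"
    by (simp only: qinner_self norm_of_real) simp
  also have "qinner z z = qinner y (A *\<^sub>v z)"
    using qinner_adjoint[of y "qadjoint A" z] y z by (simp add: z_def)
  also have "norm \<dots> \<le> qvec_norm y * qvec_norm (A *\<^sub>v z)"
    using y by (intro qinner_cauchy_schwarz) auto
  also have "\<dots> \<le> qvec_norm y * (spectral_norm A * qvec_norm z)"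
    using z by (intro mult_left_mono spectral_norm_bound) auto
  finally have "qvec_norm z * qvec_norm z \<le> spectral_norm A * qvec_norm y * qvec_norm z"
    by (simp add: power2_eq_square mult_ac)
  then show "qvec_norm (qadjoint A *\<^sub>v y) \<le> spectral_norm A * qvec_norm y"
    unfolding z_def[symmetric] using qvec_norm_nonneg[of z]
    by (cases "qvec_norm z = 0") (auto dest: mult_right_le_imp_le)
qed simp

lemma spectral_norm_qadjoint [simp]: "spectral_norm (qadjoint A) = spectral_norm A"
  using spectral_norm_qadjoint_le[of A] spectral_norm_qadjoint_le[of "qadjoint A"] by simp

text \<open>Lengths are preserved, since \<open><T x, T x> = <x, T^H T x> = <x, x>\<close>.\<close>

lemma spectral_norm_isometry:
  assumes "qadjoint T * T = 1\<^sub>m (dim_col T)"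
  shows "spectral_norm T \<le> 1"
proof (rule spectral_norm_leI)
  fix x :: qvec assume x: "dim_vec x = dim_col T"
  have "qadjoint T *\<^sub>v (T *\<^sub>v x) = qadjoint T * T *\<^sub>v x"
    using x by (intro assoc_mult_mat_vec[symmetric, of _ "dim_col T" "dim_row T" _ "dim_col T"])
      (auto intro!: carrier_vecI carrier_matI)
  also have "\<dots> = x"
    unfolding assms using x by (intro one_mult_mat_vec carrier_vecI)
  finally have "qinner (T *\<^sub>v x) (T *\<^sub>v x) = qinner x x"
    using x by (simp add: qinner_adjoint)
  then have "qvec_norm (T *\<^sub>v x) = qvec_norm x"
    by (simp only: qinner_self of_real_eq_iff) simp
  then show "qvec_norm (T *\<^sub>v x) \<le> 1 * qvec_norm x" by simp
qed simp

text \<open>For \<open>z = P x\<close> one has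
  \<open>|z|^2 = <x, P z> = <x, z> \<le> |x| |z|\<close>.\<close>

lemma spectral_norm_projection:
  assumes P: "qadjoint P = P" "P * P = P"
  shows "spectral_norm P \<le> 1"
proof (rule spectral_norm_leI)
  fix x :: qvec assume x: "dim_vec x = dim_col P"
  have sq: "dim_row P = dim_col P" using P(1) by (metis qadjoint_dim(1))
  define z where "z = P *\<^sub>v x"
  have "P *\<^sub>v z = P * P *\<^sub>v x"
    unfolding z_def using x sq
    by (intro assoc_mult_mat_vec[symmetric, of _ "dim_col P" "dim_col P" _ "dim_col P"])
      (auto intro!: carrier_vecI carrier_matI)
  then have zz: "qinner z z = qinner x z"
    using qinner_adjoint[of x P z] x by (simp add: z_def P)
  have "(qvec_norm z)\<^sup>2 = norm (qinner z z)"
    by (simp only: qinner_self norm_of_real) simp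
  also note zz
  also have "norm (qinner x z) \<le> qvec_norm x * qvec_norm z"
    using x sq by (intro qinner_cauchy_schwarz) (simp add: z_def)
  finally have "qvec_norm z * qvec_norm z \<le> qvec_norm x * qvec_norm z"
    by (simp add: power2_eq_square)
  then show "qvec_norm (P *\<^sub>v x) \<le> 1 * qvec_norm x"
    unfolding z_def[symmetric] using qvec_norm_nonneg[of z]
    by (cases "qvec_norm z = 0") (auto dest: mult_right_le_imp_le)
qed simp

lemma spectral_norm_mult_contraction_left:
  assumes "dim_col A = dim_row B" "spectral_norm A \<le> 1"
  shows "spectral_norm (A * B) \<le> spectral_norm B"
  using spectral_norm_mult[OF assms(1)] mult_right_mono[OF assms(2) spectral_norm_nonneg[of B]]
  by simp

lemma spectral_norm_mult_contraction_right:
  assumes "dim_col A = dim_row B" "spectral_norm B \<le> 1"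
  shows "spectral_norm (A * B) \<le> spectral_norm A"
  using spectral_norm_mult[OF assms(1)] mult_left_mono[OF assms(2) spectral_norm_nonneg[of A]]
  by simp

section \<open>Column and row selection\<close>

text \<open>Spans are built from finite sets of vectors, matrix products from column positions.
  Choosing one position per vector and the coefficient \<open>0\<close> elsewhere translates between
  them, also when a column is repeated. The general \<open>h\<close> covers scalars on either
  side.\<close>

lemma sum_subset_list:
  fixes c :: "'a \<Rightarrow> 'b :: zero"
  assumes F: "F \<subseteq> set vs"
  obtains b where "\<And>h :: 'a \<Rightarrow> 'b \<Rightarrow> 'c :: comm_monoid_add. (\<And>v. h v 0 = 0) \<Longrightarrow>
    (\<Sum>v\<in>F. h v (c v)) = (\<Sum>j<length vs. h (vs ! j) (b j))"
proof -
  have "\<forall>v\<in>F. \<exists>j. j < length vs \<and> vs ! j = v"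
    using F by (auto simp: in_set_conv_nth)
  then obtain idx where "\<forall>v\<in>F. idx v < length vs \<and> vs ! idx v = v"
    by (rule bchoice[THEN exE])
  then have idx: "\<And>v. v \<in> F \<Longrightarrow> idx v < length vs \<and> vs ! idx v = v"
    by blast
  have inj: "inj_on idx F" by (rule inj_onI) (metis idx)
  have "(\<Sum>v\<in>F. h v (c v)) = (\<Sum>j<length vs. h (vs ! j) (if j \<in> idx ` F then c (vs ! j) else 0))"
    if h: "\<And>v. h v 0 = 0" for h :: "'a \<Rightarrow> 'b \<Rightarrow> 'c"
  proof -
    have "(\<Sum>v\<in>F. h v (c v)) = (\<Sum>j\<in>idx ` F. h (vs ! j) (c (vs ! j)))"
      using idx by (simp add: sum.reindex[OF inj])
    also have "\<dots> = (\<Sum>j<length vs. h (vs ! j) (if j \<in> idx ` F then c (vs ! j) else 0))"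
      using idx by (intro sum.mono_neutral_cong_left) (auto simp: h)
    finally show ?thesis .
  qed
  then show ?thesis by (rule that)
qed

lemma right_span_list:
  assumes "v \<in> right_span d (set vs)"
  shows "\<exists>b. \<forall>i<d. v $ i = (\<Sum>j<length vs. vs ! j $ i * b j)"
proof -
  obtain c F where F: "F \<subseteq> set vs" "v = right_lincomb d c F"
    using assms by (auto simp: right_span_def)
  obtain b where b: "\<And>h :: qvec \<Rightarrow> quaternion \<Rightarrow> quaternion. (\<And>w. h w 0 = 0) \<Longrightarrow>
      (\<Sum>w\<in>F. h w (c w)) = (\<Sum>j<length vs. h (vs ! j) (b j))"
    using sum_subset_list[OF F(1), of c] by blast
  show ?thesis
  proof (intro exI allI impI)
    fix i assume "i < d"
    then show "v $ i = (\<Sum>j<length vs. vs ! j $ i * b j)"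
      using b[of "\<lambda>w x. w $ i * x"] by (simp add: F(2) right_lincomb_def)
  qed
qed

lemma left_span_list:
  assumes "v \<in> left_span d (set vs)"
  shows "\<exists>b. \<forall>i<d. v $ i = (\<Sum>j<length vs. b j * vs ! j $ i)"
proof -
  obtain c F where F: "F \<subseteq> set vs" "v = left_lincomb d c F"
    using assms by (auto simp: left_span_def)
  obtain b where b: "\<And>h :: qvec \<Rightarrow> quaternion \<Rightarrow> quaternion. (\<And>w. h w 0 = 0) \<Longrightarrow>
      (\<Sum>w\<in>F. h w (c w)) = (\<Sum>j<length vs. h (vs ! j) (b j))"
    using sum_subset_list[OF F(1), of c] by blast
  show ?thesis
  proof (intro exI allI impI)
    fix i assume "i < d"
    then show "v $ i = (\<Sum>j<length vs. b j * vs ! j $ i)"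
      using b[of "\<lambda>w x. x * w $ i"] by (simp add: F(2) left_lincomb_def)
  qed
qed

lemma right_span_superset:
  assumes "v \<in> S" "dim_vec v = d"
  shows "v \<in> right_span d S"
proof -
  have "v = right_lincomb d (\<lambda>_. 1) {v}"
    using assms by (intro eq_vecI) (auto simp: right_lincomb_def)
  moreover have "finite {v}" "{v} \<subseteq> S" using assms by auto
  ultimately show ?thesis unfolding right_span_def by blast
qed

lemma left_span_superset:
  assumes "v \<in> S" "dim_vec v = d"
  shows "v \<in> left_span d S"
proof -
  have "v = left_lincomb d (\<lambda>_. 1) {v}"
    using assms by (intro eq_vecI) (auto simp: left_lincomb_def)
  moreover have "finite {v}" "{v} \<subseteq> S" using assms by auto
  ultimately show ?thesis unfolding left_span_def by blast
qed

text \<open>The coefficients expressing column \<open>l\<close> of \<open>X\<close> through the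
  columns of \<open>C\<close> form column \<open>l\<close> of \<open>Y\<close>. They act on the
  right, as the matrix product requires.\<close>

lemma qcol_space_factor:
  assumes "qcol_space X \<subseteq> qcol_space C" "dim_row C = dim_row X"
  obtains Y where "Y \<in> carrier_mat (dim_col C) (dim_col X)" "X = C * Y"
proof -
  have "\<exists>b. \<forall>i<dim_row X. X $$ (i, l) = (\<Sum>j<dim_col C. C $$ (i, j) * b j)" if l: "l < dim_col X" for l
  proof -
    have "col X l \<in> qcol_space X"
      unfolding qcol_space_def using l by (intro right_span_superset) (auto simp: cols_def)
    then have "col X l \<in> right_span (dim_row X) (set (cols C))"
      using assms by (auto simp: qcol_space_def)
    then obtain b where b: "\<And>i. i < dim_row X \<Longrightarrow> col X l $ i = (\<Sum>j<length (cols C). cols C ! j $ i * b j)"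
      using right_span_list by blast
    show ?thesis
      using b l assms(2) by (intro exI[of _ b]) simp
  qed
  then obtain b where b: "\<And>l i. l < dim_col X \<Longrightarrow> i < dim_row X \<Longrightarrow>
      X $$ (i, l) = (\<Sum>j<dim_col C. C $$ (i, j) * b l j)"
    by metis
  have "X = C * mat (dim_col C) (dim_col X) (\<lambda>(j, l). b l j)"
    using assms(2) by (intro eq_matI) (auto simp: b scalar_prod_def lessThan_atLeast0)
  then show ?thesis by (intro that) auto
qed

text \<open>The coefficients of the left combinations form the rows of the left factor
  \<open>Y\<close>.\<close>

lemma qrow_space_factor:
  assumes "qrow_space X \<subseteq> qrow_space R" "dim_col R = dim_col X"
  obtains Y where "Y \<in> carrier_mat (dim_row X) (dim_row R)" "X = Y * R"
proof -
  have "\<exists>b. \<forall>i<dim_col X. X $$ (l, i) = (\<Sum>j<dim_row R. b j * R $$ (j, i))" if l: "l < dim_row X" for l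
  proof -
    have "row X l \<in> qrow_space X"
      unfolding qrow_space_def using l by (intro left_span_superset) (auto simp: rows_def)
    then have "row X l \<in> left_span (dim_col X) (set (rows R))"
      using assms by (auto simp: qrow_space_def)
    then obtain b where b: "\<And>i. i < dim_col X \<Longrightarrow> row X l $ i = (\<Sum>j<length (rows R). b j * rows R ! j $ i)"
      using left_span_list by blast
    show ?thesis
      using b l assms(2) by (intro exI[of _ b]) simp
  qed
  then obtain b where b: "\<And>l i. l < dim_row X \<Longrightarrow> i < dim_col X \<Longrightarrow>
      X $$ (l, i) = (\<Sum>j<dim_row R. b l j * R $$ (j, i))"
    by metis
  have "X = mat (dim_row X) (dim_row R) (\<lambda>(l, j). b l j) * R"
    using assms(2) by (intro eq_matI) (auto simp: b scalar_prod_def lessThan_atLeast0)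
  then show ?thesis by (intro that) auto
qed

text \<open>Selecting columns becomes right multiplication by these columns of the identity, so
  submatrices obey the laws of matrix algebra and submultiplicativity of the norm.\<close>

definition selector :: "nat \<Rightarrow> nat set \<Rightarrow> qmat" where
  "selector n J = submatrix (1\<^sub>m n) UNIV J"

lemma selector_dim [simp]: "dim_row (selector n J) = n" "dim_col (selector n J) = card {j. j < n \<and> j \<in> J}"
  by (simp_all add: selector_def dim_submatrix)

lemma selector_index:
  "i < n \<Longrightarrow> j < card {j. j < n \<and> j \<in> J} \<Longrightarrow> selector n J $$ (i, j) = (if i = pick J j then 1 else 0)"
  using pick_le[of j n J] by (simp add: selector_def submatrix_index pick_UNIV)

lemma submatrix_columns: "submatrix A UNIV J = A * selector (dim_col A) J" for A :: qmat
proof (rule eq_matI)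
  fix i j assume "i < dim_row (A * selector (dim_col A) J)" "j < dim_col (A * selector (dim_col A) J)"
  then have i: "i < dim_row A" and j: "j < card {j. j < dim_col A \<and> j \<in> J}" by auto
  have "(A * selector (dim_col A) J) $$ (i, j)
      = (\<Sum>l = 0..<dim_col A. A $$ (i, l) * (if l = pick J j then 1 else 0))"
    using i j by (simp add: scalar_prod_def selector_index)
  also have "\<dots> = A $$ (i, pick J j)"
    using pick_le[OF j] by (simp add: if_distrib[of "\<lambda>x. _ * x"] cong: if_cong)
  finally show "submatrix A UNIV J $$ (i, j) = (A * selector (dim_col A) J) $$ (i, j)"
    using i j by (simp add: submatrix_index pick_UNIV)
qed (auto simp: dim_submatrix)

text \<open>The rows of \<open>A\<close> are the conjugated columns of \<open>qadjoint A\<close>, so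
  the column case applies.\<close>

lemma submatrix_rows: "submatrix A I UNIV = qadjoint (selector (dim_row A) I) * A" for A :: qmat
proof -
  have "submatrix A I UNIV = qadjoint (submatrix (qadjoint A) UNIV I)"
  proof (rule eq_matI)
    fix i j assume "i < dim_row (qadjoint (submatrix (qadjoint A) UNIV I))"
      "j < dim_col (qadjoint (submatrix (qadjoint A) UNIV I))"
    then have "i < card {i. i < dim_row A \<and> i \<in> I}" "j < dim_col A"
      by (auto simp: dim_submatrix)
    then show "submatrix A I UNIV $$ (i, j) = qadjoint (submatrix (qadjoint A) UNIV I) $$ (i, j)"
      using pick_le[of i "dim_row A" I] by (simp add: submatrix_index pick_UNIV dim_submatrix)
  qed (auto simp: dim_submatrix)
  then show ?thesis
    by (simp add: submatrix_columns qadjoint_mult)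
qed

text \<open>Exactly \<open>i\<close> members of the part of \<open>J\<close> below \<open>n\<close>
  are smaller than its \<open>i\<close>-th element, so the element determines its position.\<close>

lemma pick_inj:
  assumes "i < card {j. j < n \<and> j \<in> J}" "j < card {j. j < n \<and> j \<in> J}" "pick J i = pick J j"
  shows "i = j"
proof -
  have "card {a \<in> {j. j < n \<and> j \<in> J}. a < pick {j. j < n \<and> j \<in> J} i} = i"
    using assms(1) by (intro card_pick) auto
  moreover have "card {a \<in> {j. j < n \<and> j \<in> J}. a < pick {j. j < n \<and> j \<in> J} j} = j"
    using assms(2) by (intro card_pick) auto
  ultimately show ?thesis
    using assms pick_reduce_set by metis
qed

text \<open>The columns are standard unit vectors, distinct by injectivity of
  \<open>pick\<close>.\<close>

lemma selector_isometry: "qadjoint (selector n J) * selector n J = 1\<^sub>m (card {j. j < n \<and> j \<in> J})"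
proof (rule eq_matI)
  fix i j assume "i < dim_row (1\<^sub>m (card {j. j < n \<and> j \<in> J}) :: qmat)"
    "j < dim_col (1\<^sub>m (card {j. j < n \<and> j \<in> J}) :: qmat)"
  then have i: "i < card {j. j < n \<and> j \<in> J}" and j: "j < card {j. j < n \<and> j \<in> J}" by auto
  have "(qadjoint (selector n J) * selector n J) $$ (i, j)
      = (\<Sum>l = 0..<n. qcnj (if l = pick J i then 1 else 0) * (if l = pick J j then 1 else 0))"
    using i j by (simp add: scalar_prod_def selector_index)
  also have "\<dots> = (\<Sum>l = 0..<n. if l = pick J j then (if pick J j = pick J i then 1 else 0) else 0)"
    by (intro sum.cong) auto
  also have "\<dots> = (if pick J j = pick J i then 1 else 0)"
    using pick_le[OF j] by simp
  also have "\<dots> = 1\<^sub>m (card {j. j < n \<and> j \<in> J}) $$ (i, j)"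
    using i j pick_inj[OF i j] by auto
  finally show "(qadjoint (selector n J) * selector n J) $$ (i, j)
      = 1\<^sub>m (card {j. j < n \<and> j \<in> J}) $$ (i, j)" .
qed auto

lemma spectral_norm_selector: "spectral_norm (selector n J) \<le> 1"
  by (rule spectral_norm_isometry) (simp add: selector_isometry)

section \<open>Perturbation bounds\<close>

text \<open>\<open>P\<close> is the orthogonal projection onto the column space of \<open>A\<close>.
  Both \<open>P\<close> and \<open>1 - P\<close> are Hermitian idempotents, hence contractions,
  however large \<open>qpinv A\<close> is.\<close>

lemma qpinv_left_projection:
  fixes A :: qmat
  defines "P \<equiv> A * qpinv A"
  shows "dim_row P = dim_row A" "dim_col P = dim_row A" "qadjoint P = P" "P * P = P" "P * A = A"
    "spectral_norm P \<le> 1" "spectral_norm (1\<^sub>m (dim_row A) - P) \<le> 1"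
proof -
  show d [simp]: "dim_row P = dim_row A" "dim_col P = dim_row A" by (simp_all add: P_def)
  have q: "A * qpinv A * A = A" using qpinv[of A] by (simp add: is_qpinv_def)
  show H: "qadjoint P = P"
    using qpinv[of A] by (simp add: is_qpinv_def P_def)
  show "P * A = A" using q by (simp add: P_def)
  then show PP: "P * P = P" by (simp add: P_def flip: mat_mult_assoc)
  show "spectral_norm P \<le> 1" by (rule spectral_norm_projection[OF H PP])
  show "spectral_norm (1\<^sub>m (dim_row A) - P) \<le> 1"
    by (rule spectral_norm_projection) (simp_all add: qadjoint_minus H mat_ring_simps PP mat_zero_simps)
qed

text \<open>Up to sign the residual is \<open>Z\<close>: the factor \<open>1 - P\<close> kills
  \<open>Ct\<close>, and \<open>C * (qpinv C * X)\<close> reproduces \<open>X\<close>. The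
  pseudoinverse of the perturbed \<open>Ct\<close> enters only through the contraction
  \<open>1 - P\<close>.\<close>

lemma column_residual_bound:
  assumes dims: "dim_row Ct = dim_row C" "dim_col Ct = dim_col C"
    and X: "X = C * Y" "dim_row Y = dim_col C"
  shows "spectral_norm (X - Ct * qpinv Ct * X)
    \<le> spectral_norm (Ct - C) * spectral_norm (qpinv C * X)"
proof -
  define P where "P = Ct * qpinv Ct"
  note P = qpinv_left_projection[of Ct, folded P_def]
  note [simp] = dims P(1,2) and X(2)[simp]
  have [simp]: "dim_row X = dim_row C" by (simp add: X)
  \<comment> \<open>By \<open>X = C * Y\<close> the columns of \<open>X\<close> lie in the range of
    \<open>C\<close>, on which \<open>C * qpinv C\<close> is the identity.\<close>
  have CX: "C * (qpinv C * X) = X"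
    using qpinv_left_projection(5)[of C] by (simp add: X(1) flip: mat_mult_assoc)
  define Z where "Z = (1\<^sub>m (dim_row C) - P) * ((Ct - C) * (qpinv C * X))"
  have "Z = Ct * (qpinv C * X) - P * (Ct * (qpinv C * X)) - (X - P * X)"
    unfolding Z_def by (simp add: mat_ring_simps CX)
  also have "P * (Ct * (qpinv C * X)) = Ct * (qpinv C * X)"
    by (simp flip: mat_mult_assoc add: P(5))
  also have "Ct * (qpinv C * X) - Ct * (qpinv C * X) - (X - P * X) = - (X - P * X)"
    by (rule eq_matI) (auto simp del: index_mult_mat(1))
  finally have "spectral_norm (X - P * X) = spectral_norm Z"
    by (simp add: spectral_norm_uminus)
  also have "\<dots> \<le> spectral_norm ((Ct - C) * (qpinv C * X))"
    unfolding Z_def using P(7) by (intro spectral_norm_mult_contraction_left) auto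
  also have "\<dots> \<le> spectral_norm (Ct - C) * spectral_norm (qpinv C * X)"
    by (intro spectral_norm_mult) auto
  finally show ?thesis by (simp add: P_def)
qed

text \<open>This is the column bound for the adjoints, which have the same spectral norms.\<close>

lemma row_residual_bound:
  assumes dims: "dim_row Rt = dim_row R" "dim_col Rt = dim_col R"
    and X: "X = Y * R" "dim_col Y = dim_row R"
  shows "spectral_norm (X - X * qpinv Rt * Rt)
    \<le> spectral_norm (Rt - R) * spectral_norm (X * qpinv R)"
proof -
  have [simp]: "dim_col X = dim_col R" by (simp add: X)
  have "spectral_norm (qadjoint X - qadjoint Rt * qpinv (qadjoint Rt) * qadjoint X)
    \<le> spectral_norm (qadjoint Rt - qadjoint R) * spectral_norm (qpinv (qadjoint R) * qadjoint X)"
    using dims X by (intro column_residual_bound[of _ _ _ "qadjoint Y"]) (auto simp: qadjoint_mult)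
  moreover have "qadjoint X - qadjoint Rt * qpinv (qadjoint Rt) * qadjoint X
      = qadjoint (X - X * qpinv Rt * Rt)"
    using dims by (simp add: qadjoint_simps qpinv_qadjoint mat_mult_assoc)
  moreover have "qadjoint Rt - qadjoint R = qadjoint (Rt - R)"
    using dims by (simp add: qadjoint_minus)
  moreover have "qpinv (qadjoint R) * qadjoint X = qadjoint (X * qpinv R)"
    by (simp add: qadjoint_mult qpinv_qadjoint)
  ultimately show ?thesis by simp
qed

text \<open>Only the contraction property of the two projections is used; \<open>C\<close> and
  \<open>R\<close> will be instantiated by the perturbed submatrices \<open>Ct\<close> and
  \<open>Rt\<close>.\<close>

lemma projected_approximation_bound:
  assumes E: "dim_row E = dim_row X" "dim_col E = dim_col X"
    and dims: "dim_row C = dim_row X" "dim_col R = dim_col X"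
  shows "spectral_norm (X - C * qpinv C * (X + E) * qpinv R * R)
    \<le> spectral_norm (X - C * qpinv C * X) + spectral_norm (X - X * qpinv R * R) + spectral_norm E"
proof -
  define P where "P = C * qpinv C"
  define Q where "Q = qpinv R * R"
  note P = qpinv_left_projection[of C, folded P_def]
  \<comment> \<open>The right projection is the adjoint of the left projection belonging to
    \<open>qadjoint R\<close>, hence a contraction too.\<close>
  have "Q = qadjoint (qadjoint R * qpinv (qadjoint R))"
    by (simp add: Q_def qadjoint_mult qpinv_qadjoint)
  then have Q: "spectral_norm Q \<le> 1"
    using qpinv_left_projection(6)[of "qadjoint R"] by simp
  have [simp]: "dim_row P = dim_row X" "dim_col P = dim_row X" "dim_row Q = dim_col X" "dim_col Q = dim_col X"
    using dims by (simp_all add: P_def Q_def)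
  note [simp] = E dims
  have "X - P * (X + E) * Q = X - (P * X * Q + P * E * Q)"
    by (simp add: mat_ring_simps)
  \<comment> \<open>Inserting \<open>P * X\<close> separates the column residual from the row
    residual, which appears multiplied by \<open>P\<close>.\<close>
  also have "\<dots> = (X - P * X) + (P * X - P * X * Q) - P * E * Q"
    by (rule eq_matI) (auto simp del: index_mult_mat(1))
  also have "P * X - P * X * Q = P * (X - X * Q)"
    by (simp add: mat_ring_simps)
  finally have "spectral_norm (X - P * (X + E) * Q)
      \<le> spectral_norm (X - P * X + P * (X - X * Q)) + spectral_norm (P * E * Q)"
    by (simp add: spectral_norm_minus)
  also have "spectral_norm (X - P * X + P * (X - X * Q))
      \<le> spectral_norm (X - P * X) + spectral_norm (P * (X - X * Q))"
    by (rule spectral_norm_add) auto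
  also have "spectral_norm (P * (X - X * Q)) \<le> spectral_norm (X - X * Q)"
    by (rule spectral_norm_mult_contraction_left) (auto simp: P(6))
  also have "spectral_norm (P * E * Q) \<le> spectral_norm (P * E)"
    by (rule spectral_norm_mult_contraction_right) (auto simp: Q)
  also have "spectral_norm (P * E) \<le> spectral_norm E"
    by (rule spectral_norm_mult_contraction_left) (auto simp: P(6))
  finally show ?thesis
    by (simp add: P_def Q_def mat_mult_assoc)
qed

section \<open>The truncated singular value decomposition\<close>

lemma truncated_qsvd_inverse:
  assumes "truncated_qsvd X k W S V"
  obtains S' where "S' \<in> carrier_mat k k" "S * S' = 1\<^sub>m k" "S' * S = 1\<^sub>m k"
proof -
  have S: "S \<in> carrier_mat k k"
    and off: "\<And>i j. i < k \<Longrightarrow> j < k \<Longrightarrow> i \<noteq> j \<Longrightarrow> S $$ (i, j) = 0"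
    and diag: "\<And>i. i < k \<Longrightarrow> S $$ (i, i) \<noteq> 0"
    using assms by (auto simp: truncated_qsvd_def)
  define S' where "S' = mat k k (\<lambda>(i, j). if i = j then inverse (S $$ (i, i)) else 0)"
  have Sij: "S $$ (i, j) = (if i = j then S $$ (i, i) else 0)" if "i < k" "j < k" for i j
    using off that by auto
  have "S * S' = 1\<^sub>m k"
  proof (rule eq_matI)
    fix i j assume "i < dim_row (1\<^sub>m k :: qmat)" "j < dim_col (1\<^sub>m k :: qmat)"
    then have ij: "i < k" "j < k" by auto
    then have "(S * S') $$ (i, j) = (\<Sum>l = 0..<k. S $$ (i, l) * S' $$ (l, j))"
      using S by (simp add: scalar_prod_def S'_def)
    also have "\<dots> = (\<Sum>l = 0..<k. if l = i then (if i = j then 1 else 0) else 0)"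
      using ij diag by (intro sum.cong refl) (auto simp: S'_def off)
    finally show "(S * S') $$ (i, j) = 1\<^sub>m k $$ (i, j)"
      using ij by simp
  qed (use S in \<open>auto simp: S'_def\<close>)
  moreover have "S' * S = 1\<^sub>m k"
  proof (rule eq_matI)
    fix i j assume "i < dim_row (1\<^sub>m k :: qmat)" "j < dim_col (1\<^sub>m k :: qmat)"
    then have ij: "i < k" "j < k" by auto
    then have "(S' * S) $$ (i, j) = (\<Sum>l = 0..<k. S' $$ (i, l) * S $$ (l, j))"
      using S by (simp add: scalar_prod_def S'_def)
    also have "\<dots> = (\<Sum>l = 0..<k. if l = i then (if i = j then 1 else 0) else 0)"
      using ij diag by (intro sum.cong refl) (auto simp: S'_def off)
    finally show "(S' * S) $$ (i, j) = 1\<^sub>m k $$ (i, j)"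
      using ij by simp
  qed (use S in \<open>auto simp: S'_def\<close>)
  ultimately show ?thesis
    by (intro that[of S']) (auto simp: S'_def)
qed

text \<open>A real diagonal \<open>S\<close> is Hermitian, so taking the adjoint just exchanges
  \<open>W\<close> and \<open>V\<close>. The estimate for \<open>V\<close> thus yields the one for
  \<open>W\<close>.\<close>

lemma truncated_qsvd_qadjoint:
  assumes "truncated_qsvd X k W S V"
  shows "truncated_qsvd (qadjoint X) k V S W"
proof -
  have c: "W \<in> carrier_mat (dim_row X) k" "V \<in> carrier_mat (dim_col X) k" "S \<in> carrier_mat k k"
    and X: "X = W * S * qadjoint V"
    and off: "\<And>i j. i < k \<Longrightarrow> j < k \<Longrightarrow> i \<noteq> j \<Longrightarrow> S $$ (i, j) = 0"
    and diag: "\<And>i. i < k \<Longrightarrow> \<exists>s>0. S $$ (i, i) = of_real s"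
    using assms unfolding truncated_qsvd_def by blast+
  have "qadjoint S = S"
  proof (rule eq_matI)
    fix i j assume "i < dim_row S" "j < dim_col S"
    then have ij: "i < k" "j < k" using c by auto
    have "qcnj (S $$ (i, i)) = S $$ (i, i)"
      using diag[OF ij(1)] by auto
    then show "qadjoint S $$ (i, j) = S $$ (i, j)"
      using ij c off[of i j] off[of j i] by (cases "i = j") auto
  qed (use c in auto)
  then have "qadjoint X = V * S * qadjoint W"
    using c by (subst X) (simp add: qadjoint_mult mat_mult_assoc)
  then show ?thesis
    using assms unfolding truncated_qsvd_def qadjoint_dim by blast
qed

text \<open>With \<open>C = X T = W S (V\<^sup>H T)\<close> and \<open>G = (V\<^sup>H T)\<^sup>\<dagger>\<close>, the matrix \<open>V\<^sup>H T\<close> has a right inverse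
  because \<open>X\<close> factors through \<open>C\<close>. Hence \<open>(V\<^sup>H T) G = 1\<close> and \<open>C\<^sup>\<dagger> = G S\<^sup>-\<^sup>1 W\<^sup>H\<close>, so \<open>C\<^sup>\<dagger> X = G V\<^sup>H\<close>.\<close>

lemma qpinv_column_submatrix_bound:
  assumes svd: "truncated_qsvd X k W S V"
    and T: "dim_row T = dim_col X" and Y: "dim_row Y = dim_col T" "X = X * T * Y"
  shows "spectral_norm (qpinv (X * T) * X) \<le> spectral_norm (qpinv (qadjoint T * V))"
proof -
  have W: "W \<in> carrier_mat (dim_row X) k" and V: "V \<in> carrier_mat (dim_col X) k"
    and S: "S \<in> carrier_mat k k"
    and WW: "qadjoint W * W = 1\<^sub>m k" and VV: "qadjoint V * V = 1\<^sub>m k"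
    and X: "X = W * S * qadjoint V"
    using svd unfolding truncated_qsvd_def by blast+
  obtain S' where S': "S' \<in> carrier_mat k k" "S * S' = 1\<^sub>m k" "S' * S = 1\<^sub>m k"
    using truncated_qsvd_inverse[OF svd] .
  have Ydim: "dim_col Y = dim_col X" using arg_cong[OF Y(2), of dim_col] by simp
  have [simp]: "dim_row W = dim_row X" "dim_col W = k" "dim_row V = dim_col X" "dim_col V = k"
    "dim_row S = k" "dim_col S = k" "dim_row S' = k" "dim_col S' = k"
    using W V S S' by auto
  note [simp] = T Y(1) Ydim
  have cancel: "S' * (S * Z) = Z" "S * (S' * Z) = Z" "qadjoint W * (W * Z) = Z" if "dim_row Z = k" for Z
    using that by (simp_all add: S' WW flip: mat_mult_assoc)
  define M where "M = qadjoint V * T"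
  define G where "G = qpinv M"
  have [simp]: "dim_row M = k" "dim_col M = dim_col T" "dim_row G = dim_col T" "dim_col G = k"
    by (simp_all add: M_def G_def)
  have XM: "X * T = W * (S * M)"
    by (subst X) (simp add: M_def mat_mult_assoc)
  have VX: "S' * (qadjoint W * X) = qadjoint V"
    by (subst X) (simp add: mat_mult_assoc cancel)
  \<comment> \<open>Substituting \<open>X = X * T * Y\<close> and cancelling \<open>W * S\<close> on
    the left turns the factorisation of \<open>X\<close> into one of
    \<open>qadjoint V\<close>.\<close>
  have "qadjoint V = S' * (qadjoint W * (X * T * Y))"
    using VX Y(2) by simp
  also have "\<dots> = M * Y"
    unfolding XM by (simp add: mat_mult_assoc cancel)
  finally have "M * Y = qadjoint V" ..
  then have MN: "M * (Y * V) = 1\<^sub>m k"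
    by (simp add: VV flip: mat_mult_assoc)
  \<comment> \<open>Once \<open>M\<close> has some right inverse, \<open>M * G * M = M\<close>
    forces \<open>G\<close> to be one as well.\<close>
  have MG: "M * G = 1\<^sub>m k"
  proof -
    have "M * G = M * G * (M * (Y * V))" by (simp add: MN)
    also have "\<dots> = M * G * M * (Y * V)" by (simp add: mat_mult_assoc)
    also have "M * G * M = M"
      using qpinv[of M] by (simp add: G_def is_qpinv_def)
    finally show ?thesis by (simp add: MN)
  qed
  have MGc: "M * (G * Z) = Z" if "dim_row Z = k" for Z
    using that by (simp add: MG flip: mat_mult_assoc)
  \<comment> \<open>The reverse order law for \<open>W * S * M\<close>, valid because
    \<open>W * S\<close> has a left inverse built from \<open>W^H\<close> and \<open>M\<close> has a
    right inverse. The two products are \<open>W W^H\<close> and \<open>G M\<close>, both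
    Hermitian.\<close>
  define B where "B = G * (S' * qadjoint W)"
  have [simp]: "dim_row B = dim_col T" "dim_col B = dim_row X" by (simp_all add: B_def)
  have CB: "X * T * B = W * qadjoint W"
    unfolding XM B_def by (simp add: mat_mult_assoc MGc cancel)
  have BC: "B * (X * T) = G * M"
    unfolding XM B_def by (simp add: mat_mult_assoc cancel)
  have "is_qpinv (X * T) B"
    unfolding is_qpinv_def
  proof (intro conjI)
    show "B \<in> carrier_mat (dim_col (X * T)) (dim_row (X * T))"
      by (intro carrier_matI) simp_all
    show "X * T * B * (X * T) = X * T"
      unfolding CB unfolding XM by (simp add: mat_mult_assoc cancel)
    show "B * (X * T) * B = B"
      unfolding BC by (simp add: B_def mat_mult_assoc MGc)
    show "qadjoint (X * T * B) = X * T * B"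
      unfolding CB by (simp add: qadjoint_mult)
    show "qadjoint (B * (X * T)) = B * (X * T)"
      unfolding BC using qpinv[of M] by (simp add: G_def is_qpinv_def)
  qed
  then have "qpinv (X * T) = B" by (rule qpinv_eqI)
  then have "qpinv (X * T) * X = G * qadjoint V"
    by (simp add: B_def mat_mult_assoc VX)
  moreover have "spectral_norm (G * qadjoint V) \<le> spectral_norm G"
    using spectral_norm_isometry[of V] VV by (intro spectral_norm_mult_contraction_right) auto
  moreover have "qadjoint T * V = qadjoint M" by (simp add: M_def qadjoint_mult)
  ultimately show ?thesis by (simp add: qpinv_qadjoint G_def)
qed

section \<open>Assembly of both bounds from the column and row estimates\<close>

theorem theorem1:
  fixes m n k :: nat
    and X E W S V C R Xt Ct Rt EJ EI WI VJ :: "quaternion mat"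
    and I J :: "nat set"
  assumes "X \<in> carrier_mat m n"
    and "qrank X = k"
    and "truncated_qsvd X k W S V"
    and "I \<subseteq> {..<m}" and "J \<subseteq> {..<n}"
    and "card I \<ge> k" and "card J \<ge> k"
    and "C = submatrix X UNIV J"
    and "R = submatrix X I UNIV"
    and "qcol_space C = qcol_space X"
    and "qrow_space R = qrow_space X"
    and "E \<in> carrier_mat m n"
    and "Xt = X + E"
    and "Ct = submatrix Xt UNIV J"
    and "Rt = submatrix Xt I UNIV"
    and "EJ = submatrix E UNIV J"
    and "EI = submatrix E I UNIV"
    and "WI = submatrix W I UNIV"
    and "VJ = submatrix V J UNIV"
  shows "spectral_norm (X - Ct * qpinv Ct * Xt * qpinv Rt * Rt)
           \<le> spectral_norm EI * spectral_norm (X * qpinv R)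
             + spectral_norm EJ * spectral_norm (qpinv C * X)
             + 3 * spectral_norm E
         \<and> spectral_norm (X - Ct * qpinv Ct * Xt * qpinv Rt * Rt)
           \<le> spectral_norm E * (spectral_norm (qpinv WI) + spectral_norm (qpinv VJ) + 3)"
proof -
  \<comment> \<open>Right multiplication by \<open>T\<close> selects the columns in
    \<open>J\<close>, left multiplication by \<open>qadjoint U\<close> the rows in
    \<open>I\<close>.\<close>
  define T where "T = selector n J"
  define U where "U = selector m I"
  have XE: "X \<in> carrier_mat m n" "E \<in> carrier_mat m n" by fact+
  have svd: "truncated_qsvd X k W S V" by fact
  have dims [simp]: "dim_row X = m" "dim_col X = n" "dim_row E = m" "dim_col E = n"
    "dim_row T = n" "dim_row U = m"
    using XE by (auto simp: T_def U_def)
  have WV: "dim_row W = m" "dim_row V = n"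
    using svd by (auto simp: truncated_qsvd_def)
  note sub_defs = assms(8,9,13-19)
  have C: "C = X * T" and R: "R = qadjoint U * X"
    and Ct: "Ct = (X + E) * T" and Rt: "Rt = qadjoint U * (X + E)"
    and EJ: "EJ = E * T" and EI: "EI = qadjoint U * E"
    and WI: "WI = qadjoint U * W" and VJ: "VJ = qadjoint T * V"
    unfolding sub_defs by (simp_all add: submatrix_columns submatrix_rows T_def U_def WV)
  have CtC: "Ct - C = EJ"
    by (rule eq_matI) (auto simp: C Ct EJ mat_add_mult simp del: index_mult_mat(1))
  have RtR: "Rt - R = EI"
    by (rule eq_matI) (auto simp: R Rt EI mat_mult_add simp del: index_mult_mat(1))
  have "qcol_space X \<subseteq> qcol_space C" "dim_row C = dim_row X"
    using assms(10) by (simp_all add: C)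
  then obtain Y where Y: "Y \<in> carrier_mat (dim_col C) (dim_col X)" "X = C * Y"
    by (rule qcol_space_factor)
  have "qrow_space X \<subseteq> qrow_space R" "dim_col R = dim_col X"
    using assms(11) by (simp_all add: R)
  then obtain Z where Z: "Z \<in> carrier_mat (dim_row X) (dim_row R)" "X = Z * R"
    by (rule qrow_space_factor)
  have "spectral_norm (X - Ct * qpinv Ct * X) \<le> spectral_norm EJ * spectral_norm (qpinv C * X)"
    unfolding CtC[symmetric] using Y(1) by (intro column_residual_bound[OF _ _ Y(2)]) (simp_all add: C Ct)
  moreover have "spectral_norm (X - X * qpinv Rt * Rt) \<le> spectral_norm EI * spectral_norm (X * qpinv R)"
    unfolding RtR[symmetric] using Z(1) by (intro row_residual_bound[OF _ _ Z(2)]) (simp_all add: R Rt)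
  moreover have "spectral_norm (X - Ct * qpinv Ct * Xt * qpinv Rt * Rt)
      \<le> spectral_norm (X - Ct * qpinv Ct * X) + spectral_norm (X - X * qpinv Rt * Rt) + spectral_norm E"
    unfolding assms(13) by (rule projected_approximation_bound) (auto simp: Ct Rt)
  ultimately have bound: "spectral_norm (X - Ct * qpinv Ct * Xt * qpinv Rt * Rt)
      \<le> spectral_norm EI * spectral_norm (X * qpinv R)
        + spectral_norm EJ * spectral_norm (qpinv C * X) + spectral_norm E"
    by linarith
  \<comment> \<open>The spanning assumption enters the second bound in this form: it makes
    \<open>qadjoint V * T\<close> right invertible.\<close>
  have "X = X * T * Y"
    using Y(2) unfolding C .
  then have "spectral_norm (qpinv C * X) \<le> spectral_norm (qpinv VJ)"
    unfolding C VJ using Y(1) by (intro qpinv_column_submatrix_bound[OF svd]) (simp_all add: C)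
  moreover have "spectral_norm (X * qpinv R) \<le> spectral_norm (qpinv WI)"
  proof -
    \<comment> \<open>Rows are handled through \<open>qadjoint X\<close>, in whose decomposition
      \<open>V\<close> and \<open>W\<close> are exchanged, so \<open>WI\<close> takes the place of
      \<open>VJ\<close>.\<close>
    have RH: "qadjoint R = qadjoint X * U"
      by (simp add: R qadjoint_mult)
    have "qadjoint X = qadjoint (Z * R)"
      by (rule arg_cong[OF Z(2)])
    also have "\<dots> = qadjoint R * qadjoint Z"
      using Z(1) by (intro qadjoint_mult) simp
    finally have "qadjoint X = qadjoint X * U * qadjoint Z"
      unfolding RH .
    then have "spectral_norm (qpinv (qadjoint X * U) * qadjoint X) \<le> spectral_norm (qpinv WI)"
      unfolding WI using Z(1)
      by (intro qpinv_column_submatrix_bound[OF truncated_qsvd_qadjoint[OF svd]]) (simp_all add: R)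
    moreover have "qpinv (qadjoint X * U) * qadjoint X = qadjoint (X * qpinv R)"
      unfolding RH[symmetric] using \<open>dim_col R = dim_col X\<close>
      by (simp add: qadjoint_mult qpinv_qadjoint)
    ultimately show ?thesis by simp
  qed
  moreover have "spectral_norm EJ \<le> spectral_norm E"
    unfolding EJ T_def by (intro spectral_norm_mult_contraction_right spectral_norm_selector) simp
  moreover have "spectral_norm EI \<le> spectral_norm E"
    unfolding EI U_def by (intro spectral_norm_mult_contraction_left) (simp_all add: spectral_norm_selector)
  ultimately have "spectral_norm EI * spectral_norm (X * qpinv R)
      + spectral_norm EJ * spectral_norm (qpinv C * X)
      \<le> spectral_norm E * spectral_norm (qpinv WI) + spectral_norm E * spectral_norm (qpinv VJ)"
    by (intro add_mono mult_mono) simp_all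
  \<comment> \<open>\<open>bound\<close> contains \<open>spectral_norm E\<close> once; nonnegativity
    enlarges this to the constant \<open>3\<close> in both inequalities.\<close>
  with bound show ?thesis
    using spectral_norm_nonneg[of E] unfolding distrib_left by (intro conjI) linarith+
qed

end
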